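(* Let $\phi$ be an ignition function with ignition level $u_i>0$, and let $(u,z)(x,t)=(\bar u,\bar z)(x-st)$ be a strong detonation wave of the inviscid Majda model $$u_t+\left(\tfrac{u^2}{2}\right)_x=kq\,\phi(u)z,\qquad z_t=-k\,\phi(u)z,$$ with limiting states $u_\pm$ and Neumann state $u_*=\bar u(0^-)$. Suppose that $$\frac{d}{du}\ln(\phi(u))\le \frac{2u-u_*-u_+}{(u-u_* )(u-u_+)+q(u_*+u_+)}\qquad\text{for all } u\in(u_-,u_*].$$ Then the wave is weakly spectrally stable, i.e. it has no unstable eigenvalue: its Evans-Lopatinsky determinant $\Delta(\lambda)$ has no roots in $\{\lambda\in\mathbb{C}:\Re\lambda>0\}$.
   Context: Parameters: $q\ge 0$ (heat release), $k>0$ (reaction rate). An ignition function with ignition level $u_i>0$ is a function $\phi$ with $\phi(u)=0$ for $u\le u_i$ and $\phi(u)>0$ for $u>u_i$, smooth on $(u_i,\infty)$. Strong detonation wave: a traveling wave $(\bar u,\bar z)(x-st)$ with $\lim_{\xi\to\pm\infty}(\bar u,\bar z)(\xi)=(u_\pm,z_\pm)$, where $z_-=0$, $z_+=1$, $0\le u_+<u_i<u_-$, $u_+<s<u_-$; the profile is smooth except at a single shock at $\xi=0$, is constant, $(\bar u,\bar z)\equiv(u_+,1)$, for $\xi>0$, satisfies the traveling wave ODE for $\xi<0$, and satisfies the Rankine-Hugoniot conditions at $\xi=0$ with a genuine jump in $\bar u$, so that $\bar z(0^-)=1$ and $u_*:=\bar u(0^-)$ satisfies $u_*+u_+=2s$.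 Rescaling: set $\tilde x=x/s$, $\tilde t=t$, $\tilde u=\frac{u-u_+}{s-u_+}$, $\tilde z=z$, $\tilde q=\frac{q}{s-u_+}$, $\tilde\phi(\tilde u)=k\phi(u)$, $\omega=\frac{s-u_+}{s}\in(0,1]$. The system becomes $$\tilde u_{\tilde t}+\left(\omega\tfrac{\tilde u^2}{2}+(1-\omega)\tilde u\right)_{\tilde x}=\tilde q\tilde\phi(\tilde u)\tilde z,\qquad \tilde z_{\tilde t}=-\tilde\phi(\tilde u)\tilde z,$$ and the wave becomes a traveling wave of speed $1$ with $(\tilde u,\tilde z)\equiv(0,1)$ for $\xi>0$, $\tilde u(0^-)=2$, $\tilde z(0^-)=1$. Tildes are dropped from here on in this context. For $\xi<0$ the rescaled profile satisfies $\bar z'=\phi(\bar u)\bar z$ and $\bar u=1+\sqrt{1-2q(1-\bar z)/\omega}$, so the rescaled left state is $u_-=1+\sqrt{1-2q/\omega}$ with $2q<\omega$. Evans-Lopatinsky determinant (rescaled variables): let $$A=\begin{pmatrix}\omega(\bar u-1)&0\\0&-1\end{pmatrix},\quad E=\begin{pmatrix}q\bar z\phi_u(\bar u)&q\phi(\bar u)\\-\bar z\phi_u(\bar u)&-\phi(\bar u)\end{pmatrix},\quad \overline W=\begin{pmatrix}\bar u\\\bar z\end{pmatrix},\quad R(\overline W)=\begin{pmatrix}q\phi(\bar u)\bar z\\-\phi(\bar u)\bar z\end{pmatrix},$$ and $[f]:=f(0^+)-f(0^-)$. For $\xi<0$ consider the interior equation $\partial_\xi(Av)=(E-\lambda\,\mathrm{Id})v$.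 The limiting matrix $A^{-1}(-\infty)(E(-\infty)-\lambda\,\mathrm{Id})$ has eigenvalues $-\lambda/\sqrt{\omega^2-2q\omega}$ and $\lambda+\phi(u_-)$, so for $\Re\lambda\ge0$ the space of solutions exponentially decaying as $\xi\to-\infty$ is one-dimensional. Let $v=v(\lambda,\xi)$ be a nontrivial decaying solution, i.e. the mode associated with the eigenvalue $\lambda+\phi(u_-)$, chosen analytic in $\lambda$ in a neighborhood of $\{\Re\lambda\ge0\}$. Then $$\Delta(\lambda)=\det\left(\,[\lambda\overline W-R(\overline W)]\ \ \ A(0^-)v(\lambda,0^-)\,\right).$$ Its roots do not depend on the choice of $v$. *)

theory Defs
  imports "HOL-Analysis.Analysis"
begin

text \<open>Infinite differentiability; only used on open sets of reals.\<close>

definition smooth_on :: "real set \<Rightarrow> (real \<Rightarrow> real) \<Rightarrow> bool" where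
  "smooth_on S f \<longleftrightarrow> (\<forall>n. \<forall>x\<in>S. (deriv ^^ n) f field_differentiable (at x))"

definition ignition_function :: "(real \<Rightarrow> real) \<Rightarrow> real \<Rightarrow> bool" where
  "ignition_function \<phi> ui \<longleftrightarrow>
     0 < ui \<and> (\<forall>u\<le>ui. \<phi> u = 0) \<and> (\<forall>u>ui. 0 < \<phi> u) \<and> smooth_on {ui<..} \<phi>"

text \<open>
  The profile \<open>(U, Z)\<close> of the wave \<open>(u, z)(x, t) = (U, Z)(x - s t)\<close> of
  \<open>u\<^sub>t + (u\<^sup>2/2)\<^sub>x = k q \<phi>(u) z\<close>, \<open>z\<^sub>t = - k \<phi>(u) z\<close>, with \<open>um = U(-\<infinity>)\<close>,
  \<open>up = U(+\<infinity>)\<close> and Neumann state \<open>us = U(0\<^sup>-)\<close>.  The last conjunct states the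
  Rankine-Hugoniot conditions \<open>s [u] = [u\<^sup>2/2]\<close> and \<open>s [z] = 0\<close> at the shock together
  with the genuineness of the jump; hence \<open>us + up = 2 s\<close> and \<open>Z(0\<^sup>-) = 1\<close>.
  The values \<open>U 0\<close> and \<open>Z 0\<close> are irrelevant.
\<close>

definition strong_detonation ::
  "real \<Rightarrow> real \<Rightarrow> (real \<Rightarrow> real) \<Rightarrow> real \<Rightarrow> real \<Rightarrow> real \<Rightarrow> real \<Rightarrow> real
     \<Rightarrow> (real \<Rightarrow> real) \<Rightarrow> (real \<Rightarrow> real) \<Rightarrow> bool" where
  "strong_detonation q k \<phi> ui s um up us U Z \<longleftrightarrow>
     (U \<longlongrightarrow> um) at_bot \<and> (Z \<longlongrightarrow> 0) at_bot \<and>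
     (U \<longlongrightarrow> up) at_top \<and> (Z \<longlongrightarrow> 1) at_top \<and>
     0 \<le> up \<and> up < ui \<and> ui < um \<and> up < s \<and> s < um \<and>
     (\<forall>\<xi>>0. U \<xi> = up \<and> Z \<xi> = 1) \<and>
     smooth_on {..<0} U \<and> smooth_on {..<0} Z \<and>
     (\<forall>\<xi><0.
        ((\<lambda>\<xi>. - s * U \<xi> + (U \<xi>)\<^sup>2 / 2) has_real_derivative k * q * \<phi> (U \<xi>) * Z \<xi>) (at \<xi>) \<and>
        ((\<lambda>\<xi>. - s * Z \<xi>) has_real_derivative - k * \<phi> (U \<xi>) * Z \<xi>) (at \<xi>)) \<and>
     (U \<longlongrightarrow> us) (at_left 0) \<and>
     (\<exists>zs. (Z \<longlongrightarrow> zs) (at_left 0) \<and>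
           s * (up - us) = up\<^sup>2 / 2 - us\<^sup>2 / 2 \<and> s * (1 - zs) = 0 \<and> us \<noteq> up)"

text \<open>
  Rescaled quantities.  Since \<open>x - s t = s (x / s - t)\<close>, the rescaled profiles are
  functions of \<open>\<xi> / s\<close>.
\<close>

definition resc_omega :: "real \<Rightarrow> real \<Rightarrow> real" where
  "resc_omega s up = (s - up) / s"

definition resc_q :: "real \<Rightarrow> real \<Rightarrow> real \<Rightarrow> real" where
  "resc_q s up q = q / (s - up)"

definition resc_phi :: "real \<Rightarrow> real \<Rightarrow> real \<Rightarrow> (real \<Rightarrow> real) \<Rightarrow> real \<Rightarrow> real" where
  "resc_phi s up k \<phi> = (\<lambda>u. k * \<phi> (up + (s - up) * u))"

definition resc_U :: "real \<Rightarrow> real \<Rightarrow> (real \<Rightarrow> real) \<Rightarrow> real \<Rightarrow> real" where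
  "resc_U s up U = (\<lambda>\<xi>. (U (s * \<xi>) - up) / (s - up))"

definition resc_Z :: "real \<Rightarrow> (real \<Rightarrow> real) \<Rightarrow> real \<Rightarrow> real" where
  "resc_Z s Z = (\<lambda>\<xi>. Z (s * \<xi>))"

text \<open>The remaining definitions are in rescaled variables.\<close>

definition matA :: "real \<Rightarrow> (real \<Rightarrow> real) \<Rightarrow> real \<Rightarrow> complex^2^2" where
  "matA \<omega> U \<xi> = vector [vector [of_real (\<omega> * (U \<xi> - 1)), 0], vector [0, -1]]"

definition matE ::
  "real \<Rightarrow> (real \<Rightarrow> real) \<Rightarrow> (real \<Rightarrow> real) \<Rightarrow> (real \<Rightarrow> real) \<Rightarrow> real \<Rightarrow> complex^2^2" where
  "matE q \<phi> U Z \<xi> = vector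
     [vector [of_real (q * Z \<xi> * deriv \<phi> (U \<xi>)), of_real (q * \<phi> (U \<xi>))],
      vector [of_real (- Z \<xi> * deriv \<phi> (U \<xi>)), of_real (- \<phi> (U \<xi>))]]"

definition vecW :: "(real \<Rightarrow> real) \<Rightarrow> (real \<Rightarrow> real) \<Rightarrow> real \<Rightarrow> complex^2" where
  "vecW U Z \<xi> = vector [of_real (U \<xi>), of_real (Z \<xi>)]"

definition vecR ::
  "real \<Rightarrow> (real \<Rightarrow> real) \<Rightarrow> (real \<Rightarrow> real) \<Rightarrow> (real \<Rightarrow> real) \<Rightarrow> real \<Rightarrow> complex^2" where
  "vecR q \<phi> U Z \<xi> = vector [of_real (q * \<phi> (U \<xi>) * Z \<xi>), of_real (- \<phi> (U \<xi>) * Z \<xi>)]"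

definition jump :: "(real \<Rightarrow> 'a::{t2_space,minus}) \<Rightarrow> 'a" where
  "jump f = Lim (at_right 0) f - Lim (at_left 0) f"

text \<open>\<open>mat lam\<close> is \<open>lam\<close> times the identity matrix.\<close>

definition interior_solution ::
  "real \<Rightarrow> real \<Rightarrow> (real \<Rightarrow> real) \<Rightarrow> (real \<Rightarrow> real) \<Rightarrow> (real \<Rightarrow> real)
     \<Rightarrow> complex \<Rightarrow> (real \<Rightarrow> complex^2) \<Rightarrow> bool" where
  "interior_solution \<omega> q \<phi> U Z lam v \<longleftrightarrow>
     (\<forall>\<xi><0. ((\<lambda>\<xi>. matA \<omega> U \<xi> *v v \<xi>)
        has_vector_derivative (matE q \<phi> U Z \<xi> - mat lam) *v v \<xi>) (at \<xi>))"

definition exp_decaying_at_bot :: "(real \<Rightarrow> complex^2) \<Rightarrow> bool" where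
  "exp_decaying_at_bot v \<longleftrightarrow>
     (\<exists>C. \<exists>\<eta>>0. eventually (\<lambda>\<xi>. norm (v \<xi>) \<le> C * exp (\<eta> * \<xi>)) at_bot)"

text \<open>
  Admissible choices of the mode \<open>v(lam, \<xi>)\<close>: an analytic family of solutions for \<open>lam\<close> in
  a neighbourhood of the closed right half-plane, which on the half-plane itself are
  nontrivial and exponentially decaying.  There the decaying solutions form a line, so this
  determines \<open>v\<close> up to a nonvanishing factor depending on \<open>lam\<close>.
\<close>

definition decaying_mode ::
  "real \<Rightarrow> real \<Rightarrow> (real \<Rightarrow> real) \<Rightarrow> (real \<Rightarrow> real) \<Rightarrow> (real \<Rightarrow> real)
     \<Rightarrow> (complex \<Rightarrow> real \<Rightarrow> complex^2) \<Rightarrow> bool" where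
  "decaying_mode \<omega> q \<phi> U Z v \<longleftrightarrow>
     (\<exists>N. open N \<and> {lam. 0 \<le> Re lam} \<subseteq> N \<and>
        (\<forall>\<xi><0. \<forall>i. (\<lambda>lam. v lam \<xi> $ i) holomorphic_on N) \<and>
        (\<forall>lam\<in>N. interior_solution \<omega> q \<phi> U Z lam (v lam))) \<and>
     (\<forall>lam. 0 \<le> Re lam \<longrightarrow> exp_decaying_at_bot (v lam) \<and> (\<exists>\<xi><0. v lam \<xi> \<noteq> 0))"

text \<open>The transpose turns the two listed vectors into columns.\<close>

definition evans_lopatinsky ::
  "real \<Rightarrow> real \<Rightarrow> (real \<Rightarrow> real) \<Rightarrow> (real \<Rightarrow> real) \<Rightarrow> (real \<Rightarrow> real)
     \<Rightarrow> (complex \<Rightarrow> real \<Rightarrow> complex^2) \<Rightarrow> complex \<Rightarrow> complex" where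
  "evans_lopatinsky \<omega> q \<phi> U Z v lam =
     det (transpose (vector
       [jump (\<lambda>\<xi>. lam *s vecW U Z \<xi> - vecR q \<phi> U Z \<xi>),
        Lim (at_left 0) (matA \<omega> U) *v Lim (at_left 0) (v lam)]))"

text \<open>
  Weak spectral stability of the wave with profile \<open>(U, Z)\<close> (original variables): the
  Evans-Lopatinsky determinant of the rescaled wave has no zero with positive real part.
  The zeros do not depend on the choice of the mode, so all choices are quantified over.
\<close>

definition weakly_spectrally_stable ::
  "real \<Rightarrow> real \<Rightarrow> (real \<Rightarrow> real) \<Rightarrow> real \<Rightarrow> real
     \<Rightarrow> (real \<Rightarrow> real) \<Rightarrow> (real \<Rightarrow> real) \<Rightarrow> bool" where
  "weakly_spectrally_stable q k \<phi> s up U Z \<longleftrightarrow>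
     (let \<omega> = resc_omega s up; q' = resc_q s up q; \<phi>' = resc_phi s up k \<phi>;
          U' = resc_U s up U; Z' = resc_Z s Z
      in \<forall>v. decaying_mode \<omega> q' \<phi>' U' Z' v \<longrightarrow>
           (\<forall>lam. 0 < Re lam \<longrightarrow> evans_lopatinsky \<omega> q' \<phi>' U' Z' v lam \<noteq> 0))"

end

theory Submission imports Defs begin

text \<open>
  Put \<open>a = \<omega> (u - 1)\<close>, \<open>F = \<phi>(u)\<close>, \<open>\<gamma> = q F z\<close>, \<open>y = v\<^sub>2\<close> and \<open>lam p = a v\<^sub>1 - q v\<^sub>2\<close>.  Then
  \<open>\<Delta>(lam) = lam (2 y + F p)\<close> at \<open>0\<^sup>-\<close>, and \<open>P = exp (- lam \<xi>) p\<close>, \<open>R = exp (- lam \<xi>) y / (F z)\<close> solve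
  \<open>R' = lam \<phi>\<^sub>u(u) P / (F a)\<close> and \<open>P' = - (1 + 1 / a) (lam P + \<gamma> R)\<close>.  With \<open>f = \<omega> u\<^sup>2 / 2 + (1 - \<omega>) u\<close> and
  \<open>\<kappa> = Re (1 / lam)\<close>, the function
  \<open>\<Phi> = - Re (R cnj P / lam) - |P|\<^sup>2 / (2 \<gamma>) - \<kappa> |P|\<^sup>2 / f\<close> satisfies
  \<open>\<Phi>' = (1 + 1 / a) \<kappa> |lam P + \<gamma> R + \<gamma> P / f|\<^sup>2 / \<gamma> + (1 / (q z) - \<phi>\<^sub>u(u) / (F a)) |P|\<^sup>2 / 2\<close>.
  On the profile the hypothesis on \<open>ln \<phi>\<close> reads \<open>q z \<phi>\<^sub>u(u) \<le> a F\<close>, so \<open>\<Phi>\<close> is nondecreasing; it vanishes at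
  \<open>-\<infinity>\<close>, hence \<open>\<Phi>(0\<^sup>-) \<ge> 0\<close>.  But \<open>\<Delta>(lam) = 0\<close> means \<open>2 R + P = 0\<close> at \<open>0\<^sup>-\<close>, where \<open>f = 2\<close>, and then
  \<open>\<Phi>(0\<^sup>-) = - |P|\<^sup>2 / (2 \<gamma>)\<close>.  So \<open>P\<close> and \<open>R\<close> vanish at \<open>0\<^sup>-\<close> and the mode is trivial.  For \<open>q = 0\<close>
  one has \<open>p = 0\<close> directly.
\<close>

section \<open>Monotonicity up to an endpoint, one-sided limits, and two algebraic facts\<close>

lemma nondecreasing_below:
  fixes g :: "real \<Rightarrow> real"
  assumes "\<And>x. x < b \<Longrightarrow> (g has_real_derivative g' x) (at x)"
    and "\<And>x. x < b \<Longrightarrow> 0 \<le> g' x" and "x \<le> y" "y < b"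
  shows "g x \<le> g y"
proof (rule DERIV_nonneg_imp_nondecreasing[OF assms(3)])
  fix t assume "t \<le> y"
  then show "\<exists>d. (g has_real_derivative d) (at t) \<and> 0 \<le> d"
    using assms(1,2)[of t] assms(4) by auto
qed

lemma limit_at_bot_le:
  fixes g :: "real \<Rightarrow> real"
  assumes "\<And>x. x < b \<Longrightarrow> (g has_real_derivative g' x) (at x)"
    and "\<And>x. x < b \<Longrightarrow> 0 \<le> g' x" and "(g \<longlongrightarrow> l) at_bot" "x < b"
  shows "l \<le> g x"
proof (rule tendsto_upperbound[OF assms(3)])
  show "\<forall>\<^sub>F y in at_bot. g y \<le> g x"
    using eventually_le_at_bot[of x]
  proof eventually_elim
    case (elim y)
    show ?case
      by (rule nondecreasing_below[where g = g and g' = g']) (fact assms elim)+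
  qed
qed simp

lemma le_limit_at_left:
  fixes g :: "real \<Rightarrow> real"
  assumes "\<And>x. x < b \<Longrightarrow> (g has_real_derivative g' x) (at x)"
    and "\<And>x. x < b \<Longrightarrow> 0 \<le> g' x" and "(g \<longlongrightarrow> l) (at_left b)" "x < b"
  shows "g x \<le> l"
proof (rule tendsto_lowerbound[OF assms(3)])
  show "\<forall>\<^sub>F y in at_left b. g x \<le> g y"
    using eventually_at_left_real[OF assms(4)]
  proof eventually_elim
    case (elim y)
    then have "x \<le> y" "y < b" by auto
    then show ?case
      by (intro nondecreasing_below[where g = g and g' = g' and b = b] assms(1,2))
  qed
qed simp

text \<open>The derivative bound makes \<open>g\<close> Lipschitz, hence uniformly continuous, so it
  extends to the closure of the interval. This supplies the values of a mode at the shock.\<close>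

lemma bounded_derivative_limit_at_left:
  fixes g :: "real \<Rightarrow> 'a::euclidean_space"
  assumes "c < b" and "\<And>x. x \<in> {c<..<b} \<Longrightarrow> (g has_vector_derivative g' x) (at x)"
    and "\<And>x. x \<in> {c<..<b} \<Longrightarrow> norm (g' x) \<le> B"
  shows "\<exists>l. (g \<longlongrightarrow> l) (at_left b)"
proof -
  have lip: "norm (g y - g x) \<le> B * norm (y - x)" if "x \<in> {c<..<b}" "y \<in> {c<..<b}" for x y
  proof (rule differentiable_bound[where f' = "\<lambda>x h. h *\<^sub>R g' x"])
    fix t assume t: "t \<in> {c<..<b}"
    show "(g has_derivative (\<lambda>h. h *\<^sub>R g' t)) (at t within {c<..<b})"
      using assms(2)[OF t] unfolding has_vector_derivative_def by (rule has_derivative_at_withinI)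
    show "onorm (\<lambda>h. h *\<^sub>R g' t) \<le> B"
      using assms(3)[OF t] by (intro onorm_le) (simp add: mult.commute[of B] mult_left_mono)
  qed (use that in auto)
  have "0 \<le> B"
    using order_trans[OF norm_ge_zero assms(3)[of "(c + b) / 2"]] assms(1) by simp
  then have "uniformly_continuous_on {c<..<b} g"
    by (intro lipschitz_on_uniformly_continuous[of B] lipschitz_onI) (simp_all only: dist_norm lip)
  then obtain l where "(g \<longlongrightarrow> l) (at b within {c<..<b})"
    using uniformly_continuous_on_extension_at_closure[of "{c<..<b}" g b] assms(1) by auto
  then have "(g \<longlongrightarrow> l) (at_left b)"
    using at_within_nhd[of b "{c<..}" "{c<..<b}" "{..<b}"] assms(1) by fastforce
  then show ?thesis ..
qed

lemma has_real_derivative_inner: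
  fixes f g :: "real \<Rightarrow> 'a::real_inner"
  assumes "(f has_vector_derivative f') (at x)" "(g has_vector_derivative g') (at x)"
  shows "((\<lambda>x. f x \<bullet> g x) has_real_derivative (f x \<bullet> g' + f' \<bullet> g x)) (at x)"
  unfolding has_real_derivative_iff_has_vector_derivative
  using bounded_bilinear.has_vector_derivative[OF bounded_bilinear_inner assms] by simp

text \<open>In the plane as a real inner product space, only the real part of a coefficient changes
  \<open>|x|\<^sup>2\<close>. With \<open>l = lam\<close> this yields the growth rates, with
  \<open>l = inverse lam\<close> the constant \<kappa>.\<close>

lemma inner_mult_self: "x \<bullet> (l * x) = Re l * (x \<bullet> x)" for x l :: complex
  by (simp add: inner_complex_def algebra_simps)

text \<open>Multiply by \<mu> and complete two squares. The budget \<open>K \<mu>\<^sup>2\<close>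
  for \<open>m\<^sup>2\<close> is split into halves, one paying for \<open>B\<^sup>2\<close>, the
  other for \<open>K\<^sup>2 \<epsilon>\<^sup>2\<close>.\<close>

lemma cone_quadratic_form:
  fixes \<mu> B K \<epsilon> n m :: real
  assumes "0 < \<mu>" "B\<^sup>2 \<le> K * \<mu>\<^sup>2 / 2" "K * \<epsilon>\<^sup>2 \<le> \<mu>\<^sup>2 / 2" "0 \<le> K"
  shows "- 2 * \<mu> * n\<^sup>2 + 2 * B * (n * m) - K * \<mu> * m\<^sup>2 + 2 * K * \<epsilon> * (n * m) \<le> 0"
proof -
  have "K * (K * \<epsilon>\<^sup>2) \<le> K * (\<mu>\<^sup>2 / 2)"
    using assms by (intro mult_left_mono) auto
  then have "0 \<le> (K * \<mu>\<^sup>2 - B\<^sup>2 - K\<^sup>2 * \<epsilon>\<^sup>2) * m\<^sup>2"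
    using assms by (intro mult_nonneg_nonneg) (auto simp: power2_eq_square algebra_simps)
  moreover have "\<mu> * (- 2 * \<mu> * n\<^sup>2 + 2 * B * (n * m) - K * \<mu> * m\<^sup>2 + 2 * K * \<epsilon> * (n * m))
     = - (\<mu> * n - B * m)\<^sup>2 - (\<mu> * n - K * \<epsilon> * m)\<^sup>2 - (K * \<mu>\<^sup>2 - B\<^sup>2 - K\<^sup>2 * \<epsilon>\<^sup>2) * m\<^sup>2"
    by (simp add: power2_eq_square algebra_simps)
  ultimately have "\<mu> * (- 2 * \<mu> * n\<^sup>2 + 2 * B * (n * m) - K * \<mu> * m\<^sup>2 + 2 * K * \<epsilon> * (n * m)) \<le> 0"
    using zero_le_power2[of "\<mu> * n - B * m"] zero_le_power2[of "\<mu> * n - K * \<epsilon> * m"] by linarith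
  then show ?thesis using assms(1) by (simp add: mult_le_0_iff)
qed

section \<open>The rescaled profile and its decaying modes\<close>

text \<open>
  \<open>F\<close> and \<open>D\<close> stand for \<open>\<phi>(u)\<close> and \<open>\<phi>\<^sub>u(u)\<close> along the profile.  Since \<open>F' = D u'\<close> and
  \<open>u' = q F z / (\<omega> (u - 1))\<close>, the assumption \<open>growth\<close> says that \<open>F / z\<close> is nonincreasing.
\<close>

locale detonation_profile =
  fixes \<omega> q u0 F0 F1 D1 Fs :: real and u z F D :: "real \<Rightarrow> real"
  assumes omega: "0 < \<omega>" "\<omega> \<le> 1" and q: "0 \<le> q" and u0: "1 < u0" and F0: "0 < F0"
    and u_ge: "\<xi> < 0 \<Longrightarrow> u0 \<le> u \<xi>" and u_le: "\<xi> < 0 \<Longrightarrow> u \<xi> \<le> 2"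
    and z_pos: "\<xi> < 0 \<Longrightarrow> 0 < z \<xi>" and z_le: "\<xi> < 0 \<Longrightarrow> z \<xi> \<le> 1"
    and F_ge: "\<xi> < 0 \<Longrightarrow> F0 \<le> F \<xi>" and F_le: "\<xi> < 0 \<Longrightarrow> F \<xi> \<le> F1"
    and D_le: "\<xi> < 0 \<Longrightarrow> \<bar>D \<xi>\<bar> \<le> D1"
    and u_deriv: "\<xi> < 0 \<Longrightarrow>
      (u has_real_derivative q * F \<xi> * z \<xi> / (\<omega> * (u \<xi> - 1))) (at \<xi>)"
    and z_deriv: "\<xi> < 0 \<Longrightarrow> (z has_real_derivative F \<xi> * z \<xi>) (at \<xi>)"
    and F_deriv: "\<xi> < 0 \<Longrightarrow>
      (F has_real_derivative D \<xi> * (q * F \<xi> * z \<xi> / (\<omega> * (u \<xi> - 1)))) (at \<xi>)"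
    and z_bot: "(z \<longlongrightarrow> 0) at_bot"
    and u_0: "(u \<longlongrightarrow> 2) (at_left 0)" and z_0: "(z \<longlongrightarrow> 1) (at_left 0)"
    and F_0: "(F \<longlongrightarrow> Fs) (at_left 0)"
    and growth: "\<xi> < 0 \<Longrightarrow> q * z \<xi> * D \<xi> \<le> \<omega> * (u \<xi> - 1) * F \<xi>"
begin

text \<open>The nonconstant diagonal entry of \<open>matA\<close>.\<close>

definition a :: "real \<Rightarrow> real" where "a \<xi> = \<omega> * (u \<xi> - 1)"

definition a0 :: real where "a0 = \<omega> * (u0 - 1)"

lemma a0_pos: "0 < a0"
  using omega u0 by (simp add: a0_def)

lemma a_bounds: "a0 \<le> a \<xi>" "a \<xi> \<le> 1" "0 < a \<xi>" if "\<xi> < 0"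
proof -
  show 1: "a0 \<le> a \<xi>" using u_ge[OF that] omega by (simp add: a_def a0_def)
  show "0 < a \<xi>" using 1 a0_pos by linarith
  have "\<omega> * (u \<xi> - 1) \<le> 1 * 1"
    by (rule mult_mono) (use u_ge[OF that] u_le[OF that] u0 omega in auto)
  then show "a \<xi> \<le> 1" by (simp add: a_def)
qed

lemma inverse_a_bounds: "1 \<le> 1 / a \<xi>" "1 / a \<xi> \<le> 1 / a0" if "\<xi> < 0"
  using a_bounds[OF that] a0_pos by (auto simp: frac_le)

lemma F_pos: "\<xi> < 0 \<Longrightarrow> 0 < F \<xi>"
  using F_ge F0 by fastforce

end

text \<open>
  For a solution \<open>v\<close> of the interior equation, \<open>y = v\<^sub>2\<close> and \<open>lam p = a v\<^sub>1 - q v\<^sub>2\<close>; the latter is the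
  conserved combination, whose derivative \<open>- lam (v\<^sub>1 + q v\<^sub>2)\<close> has a factor \<open>lam\<close>.
\<close>

locale detonation_mode = detonation_profile +
  fixes lam :: complex and p y :: "real \<Rightarrow> complex"
  assumes Re_lam: "0 < Re lam"
    and p_deriv: "\<xi> < 0 \<Longrightarrow> (p has_vector_derivative
      - ((1 / a \<xi>) *\<^sub>R (lam * p \<xi>)) - (q * (1 + 1 / a \<xi>)) *\<^sub>R y \<xi>) (at \<xi>)"
    and y_deriv: "\<xi> < 0 \<Longrightarrow> (y has_vector_derivative
      (F \<xi> + q * z \<xi> * D \<xi> / a \<xi>) *\<^sub>R y \<xi> + lam * y \<xi> + (z \<xi> * D \<xi> / a \<xi>) *\<^sub>R (lam * p \<xi>)) (at \<xi>)"
    and p_bot: "(p \<longlongrightarrow> 0) at_bot" and y_bot: "(y \<longlongrightarrow> 0) at_bot"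
begin

text \<open>
  The slow mode of the limiting system points in the direction of \<open>p\<close>, so a decaying solution must
  stay in a cone around the \<open>y\<close>-axis: \<open>K |y|\<^sup>2 - |p|\<^sup>2\<close> is nondecreasing near \<open>-\<infinity>\<close> and tends to 0 there.
\<close>

lemma cone: "\<exists>K\<ge>0. \<exists>\<Xi><0. \<forall>\<xi><\<Xi>. (norm (p \<xi>))\<^sup>2 \<le> K * (norm (y \<xi>))\<^sup>2"
proof -
  define \<mu> where "\<mu> = Re lam"
  \<comment> \<open>\<open>B\<close> bounds the coefficient of \<open>y\<close> in
    \<open>p'\<close>. \<open>K\<close> is large enough for
    \<open>B\<^sup>2 \<le> K \<mu>\<^sup>2 / 2\<close>, and \<epsilon>, the tolerated coupling of
    \<open>p\<close> into \<open>y'\<close>, satisfies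
    \<open>K \<epsilon>\<^sup>2 = \<mu>\<^sup>2 / 4\<close>.\<close>
  define B where "B = q * (1 + 1 / a0)"
  define K where "K = 2 * B\<^sup>2 / \<mu>\<^sup>2 + 1"
  define \<epsilon> where "\<epsilon> = \<mu> / (2 * sqrt K)"
  have mu: "0 < \<mu>" using Re_lam by (simp add: \<mu>_def)
  have K: "1 \<le> K" by (simp add: K_def)
  have eps: "0 < \<epsilon>" using mu K by (simp add: \<epsilon>_def)
  have BK: "B\<^sup>2 \<le> K * \<mu>\<^sup>2 / 2" using mu by (simp add: K_def field_simps)
  have Ke: "K * \<epsilon>\<^sup>2 \<le> \<mu>\<^sup>2 / 2" using K by (simp add: \<epsilon>_def power_divide power_mult_distrib)
  \<comment> \<open>\<open>z L\<close> dominates \<open>|z D / a|\<close>; the terms to be absorbed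
    carry this factor and become small with \<open>z\<close> at -infinity.\<close>
  define L where "L = D1 / a0"
  have small: "\<forall>\<^sub>F \<xi> in at_bot. c * (z \<xi> * L) < d" if "0 < d" for c d
  proof (rule order_tendstoD(2))
    show "((\<lambda>\<xi>. c * (z \<xi> * L)) \<longlongrightarrow> c * (0 * L)) at_bot"
      by (intro tendsto_intros z_bot)
  qed (use that in simp)
  have "\<forall>\<^sub>F \<xi> in at_bot. q * (z \<xi> * L) < \<mu> / 2 \<and> norm lam * (z \<xi> * L) < \<epsilon> \<and> \<xi> < 0"
    using small[of "\<mu> / 2" q] small[of \<epsilon> "norm lam"] mu eps
    by (intro eventually_conj eventually_gt_at_bot) auto
  then obtain \<Xi> where Xi: "\<And>\<xi>. \<xi> \<le> \<Xi> \<Longrightarrow> q * (z \<xi> * L) < \<mu> / 2 \<and> norm lam * (z \<xi> * L) < \<epsilon> \<and> \<xi> < 0"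
    unfolding eventually_at_bot_linorder by blast
  define V where "V = (\<lambda>\<xi>. K * (y \<xi> \<bullet> y \<xi>) - p \<xi> \<bullet> p \<xi>)"
  define V' where "V' = (\<lambda>\<xi>. 2 * K * ((F \<xi> + q * z \<xi> * D \<xi> / a \<xi> + \<mu>) * (y \<xi> \<bullet> y \<xi>)
       + (z \<xi> * D \<xi> / a \<xi>) * (y \<xi> \<bullet> (lam * p \<xi>)))
       + 2 / a \<xi> * \<mu> * (p \<xi> \<bullet> p \<xi>) + 2 * (q * (1 + 1 / a \<xi>)) * (p \<xi> \<bullet> y \<xi>))"
  have V_deriv: "(V has_real_derivative V' \<xi>) (at \<xi>)" if "\<xi> < \<Xi>" for \<xi>
  proof -
    have neg: "\<xi> < 0" using Xi[of \<xi>] that by simp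
    note d = has_real_derivative_inner[OF y_deriv[OF neg] y_deriv[OF neg]]
      has_real_derivative_inner[OF p_deriv[OF neg] p_deriv[OF neg]]
    show ?thesis
      unfolding V_def V'_def
      by (rule DERIV_cong[OF DERIV_diff[OF DERIV_cmult[OF d(1)] d(2)]])
        (simp add: inner_simps inner_mult_self \<mu>_def inner_commute[of "y \<xi>" "p \<xi>"]
          inner_commute[of "lam * p \<xi>" "y \<xi>"] inner_commute[of "lam * p \<xi>" "p \<xi>"]
          inner_commute[of "lam * y \<xi>" "y \<xi>"] algebra_simps)
  qed
  have V'_nonneg: "0 \<le> V' \<xi>" if "\<xi> < \<Xi>" for \<xi>
  proof -
    have neg: "\<xi> < 0" using Xi[of \<xi>] that by simp
    define n where "n = norm (p \<xi>)"
    define m where "m = norm (y \<xi>)"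
    have nm: "0 \<le> n * m" by (simp add: n_def m_def)
    have pp: "p \<xi> \<bullet> p \<xi> = n\<^sup>2" "y \<xi> \<bullet> y \<xi> = m\<^sup>2"
      by (simp_all add: n_def m_def power2_norm_eq_inner)
    have zD: "\<bar>z \<xi> * D \<xi> / a \<xi>\<bar> \<le> z \<xi> * L"
    proof -
      have "\<bar>D \<xi>\<bar> / a \<xi> \<le> D1 / a0"
        using D_le[OF neg] a_bounds[OF neg] a0_pos by (intro frac_le) auto
      then have "z \<xi> * (\<bar>D \<xi>\<bar> / a \<xi>) \<le> z \<xi> * L"
        unfolding L_def using z_pos[OF neg] by (intro mult_left_mono) auto
      then show ?thesis
        using z_pos[OF neg] a_bounds[OF neg] by (simp add: abs_mult)
    qed
    \<comment> \<open>The possibly negative term \<open>q z D / a\<close> costs less than half of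
      \<mu>, so the growth rate of \<open>y\<close> stays at least \<open>\<mu> / 2\<close>.\<close>
    have "- (q * (z \<xi> * L)) \<le> q * (z \<xi> * D \<xi> / a \<xi>)"
      using mult_left_mono[OF minus_le_iff[THEN iffD1, OF abs_le_D2[OF zD]] q] by simp
    then have "- (q * (z \<xi> * L)) \<le> q * z \<xi> * D \<xi> / a \<xi>"
      by (simp add: mult.assoc)
    moreover have "q * (z \<xi> * L) < \<mu> / 2"
      using Xi[of \<xi>] that by simp
    ultimately have "\<mu> / 2 \<le> F \<xi> + q * z \<xi> * D \<xi> / a \<xi> + \<mu>"
      using F_pos[OF neg] by linarith
    then have 1: "\<mu> / 2 * m\<^sup>2 \<le> (F \<xi> + q * z \<xi> * D \<xi> / a \<xi> + \<mu>) * m\<^sup>2"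
      by (intro mult_right_mono) auto
    have "\<bar>y \<xi> \<bullet> (lam * p \<xi>)\<bar> \<le> norm lam * (n * m)"
      using Cauchy_Schwarz_ineq2[of "y \<xi>" "lam * p \<xi>"] by (simp add: norm_mult n_def m_def ac_simps)
    then have "\<bar>z \<xi> * D \<xi> / a \<xi> * (y \<xi> \<bullet> (lam * p \<xi>))\<bar> \<le> (z \<xi> * L) * (norm lam * (n * m))"
      unfolding abs_mult[of "z \<xi> * D \<xi> / a \<xi>"]
      using zD order_trans[OF abs_ge_zero zD] by (intro mult_mono) auto
    also have "\<dots> = (norm lam * (z \<xi> * L)) * (n * m)" by simp
    also have "\<dots> \<le> \<epsilon> * (n * m)"
      using Xi[of \<xi>] that nm by (intro mult_right_mono) auto
    finally have 2: "- (\<epsilon> * (n * m)) \<le> z \<xi> * D \<xi> / a \<xi> * (y \<xi> \<bullet> (lam * p \<xi>))"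
      by (rule minus_le_iff[THEN iffD1, OF abs_le_D2])
    have "1 * (\<mu> * n\<^sup>2) \<le> 1 / a \<xi> * (\<mu> * n\<^sup>2)"
      using inverse_a_bounds[OF neg] mu by (intro mult_right_mono) auto
    then have 3: "2 * \<mu> * n\<^sup>2 \<le> 2 / a \<xi> * \<mu> * n\<^sup>2" by simp
    have qb: "0 \<le> q * (1 + 1 / a \<xi>)" "q * (1 + 1 / a \<xi>) \<le> B"
      using q inverse_a_bounds[OF neg] by (auto simp: B_def intro!: mult_left_mono)
    have "\<bar>q * (1 + 1 / a \<xi>) * (p \<xi> \<bullet> y \<xi>)\<bar> \<le> B * (n * m)"
      unfolding abs_mult[of "q * (1 + 1 / a \<xi>)"]
      using qb Cauchy_Schwarz_ineq2[of "p \<xi>" "y \<xi>"] by (intro mult_mono) (auto simp: n_def m_def)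
    then have 4: "- (B * (n * m)) \<le> q * (1 + 1 / a \<xi>) * (p \<xi> \<bullet> y \<xi>)"
      by (rule minus_le_iff[THEN iffD1, OF abs_le_D2])
    \<comment> \<open>This lower bound is the negative of the form in
      \<open>cone_quadratic_form\<close>.\<close>
    have "2 * K * (\<mu> / 2 * m\<^sup>2 - \<epsilon> * (n * m)) + 2 * \<mu> * n\<^sup>2 - 2 * (B * (n * m)) \<le> V' \<xi>"
    proof -
      have "2 * K * (\<mu> / 2 * m\<^sup>2 - \<epsilon> * (n * m)) \<le> 2 * K * ((F \<xi> + q * z \<xi> * D \<xi> / a \<xi> + \<mu>) * m\<^sup>2
        + z \<xi> * D \<xi> / a \<xi> * (y \<xi> \<bullet> (lam * p \<xi>)))"
        using add_mono[OF 1 2] K by (intro mult_left_mono) simp_all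
      then show ?thesis
        unfolding V'_def pp using 3 4 by linarith
    qed
    moreover have "0 \<le> 2 * K * (\<mu> / 2 * m\<^sup>2 - \<epsilon> * (n * m)) + 2 * \<mu> * n\<^sup>2 - 2 * (B * (n * m))"
      using cone_quadratic_form[OF mu BK Ke, of n m] K by (simp add: algebra_simps)
    ultimately show ?thesis by linarith
  qed
  have "(V \<longlongrightarrow> K * ((0::complex) \<bullet> 0) - (0::complex) \<bullet> 0) at_bot"
    unfolding V_def by (intro tendsto_intros p_bot y_bot)
  then have "0 \<le> V \<xi>" if "\<xi> < \<Xi>" for \<xi>
    using limit_at_bot_le[where g = V and g' = V' and b = \<Xi> and l = 0] V_deriv V'_nonneg that by simp
  then show ?thesis
    using K Xi[of \<Xi>] by (intro exI[of _ K] exI[of _ \<Xi>] conjI)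
      (auto simp: V_def power2_norm_eq_inner)
qed

end

section \<open>Integrating factors, and boundedness of the mode at minus infinity\<close>

context detonation_profile
begin

text \<open>\<open>q F z h\<close> is the logarithmic derivative of \<open>F\<close> along the
  profile, and \<open>h\<close> is the coefficient with which \<open>lam P\<close> drives
  \<open>R\<close>.\<close>

definition h :: "real \<Rightarrow> real" where "h \<xi> = D \<xi> / (F \<xi> * a \<xi>)"

lemma h_le: "\<bar>h \<xi>\<bar> \<le> D1 / (F0 * a0)" if "\<xi> < 0"
proof -
  have "F0 * a0 \<le> F \<xi> * a \<xi>"
    using F_ge[OF that] a_bounds[OF that] F0 a0_pos by (intro mult_mono) auto
  then have "\<bar>D \<xi>\<bar> / (F \<xi> * a \<xi>) \<le> D1 / (F0 * a0)"
    using D_le[OF that] F0 a0_pos by (intro frac_le) auto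
  then show ?thesis
    using F_pos[OF that] a_bounds[OF that] by (simp add: h_def abs_mult)
qed

end

context detonation_mode
begin

definition \<gamma> :: "real \<Rightarrow> real" where "\<gamma> \<xi> = q * F \<xi> * z \<xi>"

definition P :: "real \<Rightarrow> complex" where "P \<xi> = exp (- lam * of_real \<xi>) * p \<xi>"

text \<open>The factor in front of \<open>y\<close> is the integrating factor of its equation: the
  diagonal coefficient there is \<open>lam\<close> plus \<open>F + q z D / a\<close>, and the latter
  is the logarithmic derivative of \<open>F z\<close>. Hence \<open>R'\<close> has no term in
  \<open>R\<close>.\<close>

definition R :: "real \<Rightarrow> complex"
  where "R \<xi> = (1 / (F \<xi> * z \<xi>)) *\<^sub>R (exp (- lam * of_real \<xi>) * y \<xi>)"

text \<open>In terms of the mode this is \<open>exp (- lam \<xi>) a v\<^sub>1\<close>, since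
  \<open>lam p + q y = a v\<^sub>1\<close>.\<close>

definition X :: "real \<Rightarrow> complex" where "X \<xi> = lam * P \<xi> + \<gamma> \<xi> *\<^sub>R R \<xi>"

lemma exp_deriv: "((\<lambda>\<xi>. exp (- lam * of_real \<xi>)) has_vector_derivative - lam * exp (- lam * of_real \<xi>)) (at \<xi>)"
  by (auto intro!: derivative_eq_intros has_vector_derivative_real_field)

text \<open>Differentiating the exponential raises the coefficient of \<open>lam p\<close> from
  \<open>1 / a\<close> to \<open>1 + 1 / a\<close>, the same as that of \<open>q y\<close>, and the
  two terms combine to \<open>X\<close>.\<close>

lemma P_deriv: "(P has_vector_derivative - ((1 + 1 / a \<xi>) *\<^sub>R X \<xi>)) (at \<xi>)" if neg: "\<xi> < 0"
proof -
  have nz: "F \<xi> \<noteq> 0" "z \<xi> \<noteq> 0" using F_pos[OF neg] z_pos[OF neg] by auto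
  have "\<gamma> \<xi> *\<^sub>R R \<xi> = q *\<^sub>R (exp (- lam * of_real \<xi>) * y \<xi>)"
    using nz by (simp add: \<gamma>_def R_def)
  then have X: "X \<xi> = exp (- lam * of_real \<xi>) * (lam * p \<xi> + q *\<^sub>R y \<xi>)"
    by (simp add: X_def P_def algebra_simps)
  show ?thesis
    unfolding P_def[abs_def] X
    by (rule has_vector_derivative_eq_rhs[OF has_vector_derivative_mult[OF exp_deriv p_deriv[OF neg]]])
      (simp add: scaleR_conv_of_real algebra_simps)
qed

lemma R_deriv: "(R has_vector_derivative h \<xi> *\<^sub>R (lam * P \<xi>)) (at \<xi>)" if neg: "\<xi> < 0"
proof -
  have nz: "F \<xi> \<noteq> 0" "z \<xi> \<noteq> 0" "a \<xi> \<noteq> 0"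
    using F_pos[OF neg] z_pos[OF neg] a_bounds[OF neg] by auto
  have 1: "((\<lambda>\<xi>. 1 / (F \<xi> * z \<xi>)) has_real_derivative
      - (1 / (F \<xi> * z \<xi>)) * (q * z \<xi> * D \<xi> / a \<xi> + F \<xi>)) (at \<xi>)"
    using nz
    by (auto intro!: derivative_eq_intros F_deriv[OF neg] z_deriv[OF neg] simp flip: a_def)
      (simp add: field_simps power2_eq_square)
  have "h \<xi> = 1 / (F \<xi> * z \<xi>) * (z \<xi> * D \<xi> / a \<xi>)"
    using nz by (simp add: h_def)
  then show ?thesis
    unfolding R_def[abs_def] P_def
    by (intro has_vector_derivative_eq_rhs[OF has_vector_derivative_scaleR[OF 1
          has_vector_derivative_mult[OF exp_deriv y_deriv[OF neg]]]])
      (simp add: scaleR_conv_of_real algebra_simps)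
qed

lemma norm_y_eq: "\<xi> < 0 \<Longrightarrow> norm (exp (- lam * of_real \<xi>)) * norm (y \<xi>) = F \<xi> * z \<xi> * norm (R \<xi>)"
  using F_pos[of \<xi>] z_pos[of \<xi>] by (simp add: R_def norm_mult)

text \<open>By the cone bound \<open>|R'| \<le> C z' |R|\<close>, and \<open>z'\<close> is integrable at \<open>-\<infinity>\<close>.\<close>

lemma R_bounded: "\<exists>M c \<Xi>. 0 \<le> c \<and> \<Xi> < 0 \<and> (\<forall>\<xi><\<Xi>. norm (R \<xi>) \<le> M \<and> norm (P \<xi>) \<le> c * (F \<xi> * z \<xi>) * norm (R \<xi>))"
proof -
  obtain K \<Xi> where K: "0 \<le> K" and Xi: "\<Xi> < 0"
    and cone: "\<And>\<xi>. \<xi> < \<Xi> \<Longrightarrow> (norm (p \<xi>))\<^sup>2 \<le> K * (norm (y \<xi>))\<^sup>2"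
    using cone by blast
  define c where "c = sqrt K"
  have c: "0 \<le> c" using K by (simp add: c_def)
  have P_le: "norm (P \<xi>) \<le> c * (F \<xi> * z \<xi>) * norm (R \<xi>)" if "\<xi> < \<Xi>" for \<xi>
  proof -
    have "norm (p \<xi>) \<le> c * norm (y \<xi>)"
      unfolding c_def using real_sqrt_le_mono[OF cone[OF that]] by (simp add: real_sqrt_mult)
    then have "norm (exp (- lam * of_real \<xi>)) * norm (p \<xi>) \<le> norm (exp (- lam * of_real \<xi>)) * (c * norm (y \<xi>))"
      by (intro mult_left_mono) auto
    also have "\<dots> = c * (norm (exp (- lam * of_real \<xi>)) * norm (y \<xi>))"
      by (rule mult.left_commute)
    also have "\<dots> = c * (F \<xi> * z \<xi>) * norm (R \<xi>)"
      using norm_y_eq[of \<xi>] that Xi by (simp only: mult.assoc)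
    finally show ?thesis
      unfolding P_def norm_mult .
  qed
  \<comment> \<open>As \<open>z' = F z\<close>, the weight \<open>exp (C z)\<close> contributes
    \<open>C F z |R|\<^sup>2\<close>; by the bounds on \<open>h\<close> and \<open>P\<close> this
    absorbs the indefinite term \<open>2 h (R \<bullet> lam P)\<close>.\<close>
  define C where "C = 2 * (D1 / (F0 * a0)) * norm lam * c"
  define G where "G = (\<lambda>\<xi>. (R \<xi> \<bullet> R \<xi>) * exp (C * z \<xi>))"
  define G' where "G' = (\<lambda>\<xi>. exp (C * z \<xi>) * (2 * h \<xi> * (R \<xi> \<bullet> (lam * P \<xi>)) + C * (F \<xi> * z \<xi>) * (R \<xi> \<bullet> R \<xi>)))"
  have G_deriv: "(G has_real_derivative G' \<xi>) (at \<xi>)" if "\<xi> < \<Xi>" for \<xi>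
  proof -
    have neg: "\<xi> < 0" using that Xi by simp
    note d = has_real_derivative_inner[OF R_deriv[OF neg] R_deriv[OF neg]]
    have e: "((\<lambda>\<xi>. exp (C * z \<xi>)) has_real_derivative exp (C * z \<xi>) * (C * (F \<xi> * z \<xi>))) (at \<xi>)"
      by (auto intro!: derivative_eq_intros z_deriv[OF neg])
    show ?thesis
      unfolding G_def G'_def
      by (rule DERIV_cong[OF DERIV_mult[OF d e]])
        (simp add: inner_commute[of "lam * P \<xi>" "R \<xi>"] algebra_simps)
  qed
  have G'_nonneg: "0 \<le> G' \<xi>" if "\<xi> < \<Xi>" for \<xi>
  proof -
    have neg: "\<xi> < 0" using that Xi by simp
    have "\<bar>R \<xi> \<bullet> (lam * P \<xi>)\<bar> \<le> norm (R \<xi>) * (norm lam * norm (P \<xi>))"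
      using Cauchy_Schwarz_ineq2[of "R \<xi>" "lam * P \<xi>"] by (simp add: norm_mult)
    also have "\<dots> \<le> norm (R \<xi>) * (norm lam * (c * (F \<xi> * z \<xi>) * norm (R \<xi>)))"
      using P_le[OF that] by (intro mult_left_mono) auto
    finally have "\<bar>h \<xi> * (R \<xi> \<bullet> (lam * P \<xi>))\<bar>
        \<le> (D1 / (F0 * a0)) * (norm (R \<xi>) * (norm lam * (c * (F \<xi> * z \<xi>) * norm (R \<xi>))))"
      unfolding abs_mult[of "h \<xi>"] using h_le[OF neg] order_trans[OF abs_ge_zero h_le[OF neg]]
      by (intro mult_mono) auto
    also have "\<dots> = C / 2 * (F \<xi> * z \<xi>) * (R \<xi> \<bullet> R \<xi>)"
      by (simp add: C_def power2_norm_eq_inner[symmetric] power2_eq_square)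
    finally have "- (C / 2 * (F \<xi> * z \<xi>) * (R \<xi> \<bullet> R \<xi>)) \<le> h \<xi> * (R \<xi> \<bullet> (lam * P \<xi>))"
      by (rule minus_le_iff[THEN iffD1, OF abs_le_D2])
    then show ?thesis
      unfolding G'_def by (intro mult_nonneg_nonneg) auto
  qed
  define \<Xi>' where "\<Xi>' = \<Xi> - 1"
  have C: "0 \<le> C"
  proof -
    have "0 \<le> D1" using D_le[of "-1"] by simp
    then show ?thesis using c F0 a0_pos by (simp add: C_def)
  qed
  have "norm (R \<xi>) \<le> sqrt (G \<Xi>')" if "\<xi> < \<Xi>'" for \<xi>
  proof (rule real_le_rsqrt)
    have "\<xi> \<le> \<Xi>'" "\<Xi>' < \<Xi>" using that by (auto simp: \<Xi>'_def)
    then have "G \<xi> \<le> G \<Xi>'"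
      by (intro nondecreasing_below[where g = G and g' = G' and b = \<Xi>] G_deriv G'_nonneg)
    moreover have "(R \<xi> \<bullet> R \<xi>) * 1 \<le> G \<xi>"
      unfolding G_def using C z_pos[of \<xi>] that Xi by (intro mult_left_mono) (auto simp: \<Xi>'_def)
    ultimately show "(norm (R \<xi>))\<^sup>2 \<le> G \<Xi>'"
      by (simp add: power2_norm_eq_inner)
  qed
  then show ?thesis
    using P_le c Xi by (intro exI[of _ "sqrt (G \<Xi>')"] exI[of _ c] exI[of _ \<Xi>']) (auto simp: \<Xi>'_def)
qed

end

section \<open>Limits at the shock, and uniqueness from there\<close>

context detonation_profile
begin

text \<open>The flux \<open>f\<close> enters through \<open>f' = (1 + 1 / a) \<gamma>\<close> and \<open>f(2) = 2\<close>.\<close>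

definition f :: "real \<Rightarrow> real" where "f \<xi> = \<omega> * (u \<xi>)\<^sup>2 / 2 + (1 - \<omega>) * u \<xi>"

lemma f_ge: "1 / 2 \<le> f \<xi>" if "\<xi> < 0"
proof -
  have u: "1 \<le> u \<xi>" using u_ge[OF that] u0 by simp
  then have "1 \<le> (u \<xi>)\<^sup>2" by simp
  then have "\<omega> * 1 / 2 + (1 - \<omega>) * 1 \<le> f \<xi>"
    unfolding f_def using u omega by (intro add_mono divide_right_mono mult_left_mono) auto
  then show ?thesis using omega by simp
qed

lemma f_0: "(f \<longlongrightarrow> 2) (at_left 0)"
proof -
  have "(f \<longlongrightarrow> \<omega> * 2\<^sup>2 / 2 + (1 - \<omega>) * 2) (at_left 0)"
    unfolding f_def by (intro tendsto_intros u_0) auto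
  then show ?thesis by (simp add: algebra_simps)
qed

lemma Fs_pos: "0 < Fs"
proof -
  have "\<forall>\<^sub>F \<xi> in at_left 0. F0 \<le> F \<xi>"
    using eventually_at_left_real[of "-1" 0] by (auto elim!: eventually_mono intro: F_ge)
  then have "F0 \<le> Fs"
    by (intro tendsto_lowerbound[OF F_0]) auto
  then show ?thesis using F0 by simp
qed

end

context detonation_mode
begin

text \<open>The coefficients of the linear system for \<open>p\<close> and \<open>y\<close> are
  bounded on the whole half-line, since \<open>a \<ge> a0\<close>, \<open>z \<le> 1\<close> and
  \<open>F\<close>, \<open>D\<close> are bounded. This feeds the Gronwall argument at the
  shock.\<close>

lemma derivative_bounds: "\<exists>B\<ge>0. \<forall>\<xi><0.
    norm (- ((1 / a \<xi>) *\<^sub>R (lam * p \<xi>)) - (q * (1 + 1 / a \<xi>)) *\<^sub>R y \<xi>) \<le> B * (norm (p \<xi>) + norm (y \<xi>)) \<and>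
    norm ((F \<xi> + q * z \<xi> * D \<xi> / a \<xi>) *\<^sub>R y \<xi> + lam * y \<xi> + (z \<xi> * D \<xi> / a \<xi>) *\<^sub>R (lam * p \<xi>))
      \<le> B * (norm (p \<xi>) + norm (y \<xi>))"
proof (intro exI conjI allI impI)
  have D1: "0 \<le> D1" and F1: "0 \<le> F1"
    using D_le[of "-1"] F_pos[of "-1"] F_le[of "-1"] by simp_all
  note nonneg = D1 F1 q a0_pos
  \<comment> \<open>\<open>B1\<close>, \<open>B2\<close> bound the coefficients of \<open>p\<close>,
    \<open>y\<close> in \<open>p'\<close>, and \<open>B3\<close>, \<open>B4\<close> those of
    \<open>y\<close>, \<open>p\<close> in \<open>y'\<close>.\<close>
  define B1 where "B1 = 1 / a0 * norm lam"
  define B2 where "B2 = q * (1 + 1 / a0)"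
  define B3 where "B3 = F1 + q * (D1 / a0) + norm lam"
  define B4 where "B4 = D1 / a0 * norm lam"
  have B: "0 \<le> B1" "0 \<le> B2" "0 \<le> B3" "0 \<le> B4"
    using nonneg by (simp_all add: B1_def B2_def B3_def B4_def)
  then show "0 \<le> B1 + B2 + B3 + B4" by simp
  fix \<xi> :: real assume neg: "\<xi> < 0"
  define n where "n = norm (p \<xi>)"
  define m where "m = norm (y \<xi>)"
  have nm: "0 \<le> n" "0 \<le> m" by (simp_all add: n_def m_def)
  have zD: "\<bar>z \<xi> * D \<xi> / a \<xi>\<bar> \<le> D1 / a0"
  proof -
    have "z \<xi> * \<bar>D \<xi>\<bar> \<le> 1 * D1"
      using z_le[OF neg] z_pos[OF neg] D_le[OF neg] by (intro mult_mono) auto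
    then have "z \<xi> * \<bar>D \<xi>\<bar> / a \<xi> \<le> D1 / a0"
      using a_bounds[OF neg] a0_pos D1 by (intro frac_le) auto
    then show ?thesis
      using z_pos[OF neg] a_bounds[OF neg] by (simp add: abs_mult)
  qed
  have ia: "1 / a \<xi> \<le> 1 / a0" "0 \<le> 1 / a \<xi>"
    using inverse_a_bounds[OF neg] a_bounds[OF neg] by simp_all
  have "norm ((1 / a \<xi>) *\<^sub>R (lam * p \<xi>)) \<le> B1 * n"
    unfolding B1_def n_def norm_scaleR norm_mult mult.assoc
    using ia by (intro mult_right_mono) auto
  moreover have "norm ((q * (1 + 1 / a \<xi>)) *\<^sub>R y \<xi>) \<le> B2 * m"
  proof -
    have "0 \<le> q * (1 + 1 / a \<xi>)" "q * (1 + 1 / a \<xi>) \<le> B2"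
      unfolding B2_def using ia q by (auto intro!: mult_left_mono)
    then show ?thesis
      unfolding norm_scaleR m_def by (intro mult_right_mono) auto
  qed
  ultimately have "norm (- ((1 / a \<xi>) *\<^sub>R (lam * p \<xi>)) - (q * (1 + 1 / a \<xi>)) *\<^sub>R y \<xi>) \<le> B1 * n + B2 * m"
    by (intro order_trans[OF norm_triangle_ineq4]) (simp only: norm_minus_cancel add_mono)
  also have "\<dots> \<le> (B1 + B2 + B3 + B4) * n + (B1 + B2 + B3 + B4) * m"
    using B nm by (intro add_mono mult_right_mono) auto
  finally show "norm (- ((1 / a \<xi>) *\<^sub>R (lam * p \<xi>)) - (q * (1 + 1 / a \<xi>)) *\<^sub>R y \<xi>)
      \<le> (B1 + B2 + B3 + B4) * (norm (p \<xi>) + norm (y \<xi>))"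
    by (simp add: n_def m_def distrib_left)
  have "norm ((F \<xi> + q * z \<xi> * D \<xi> / a \<xi>) *\<^sub>R y \<xi> + lam * y \<xi>) \<le> B3 * m"
  proof -
    have "\<bar>q * z \<xi> * D \<xi> / a \<xi>\<bar> \<le> q * (D1 / a0)"
      using mult_left_mono[OF zD q] q by (simp add: abs_mult mult.assoc)
    moreover have "\<bar>F \<xi>\<bar> \<le> F1"
      using F_le[OF neg] F_pos[OF neg] by simp
    ultimately have "\<bar>F \<xi> + q * z \<xi> * D \<xi> / a \<xi>\<bar> \<le> F1 + q * (D1 / a0)"
      by linarith
    then have "norm ((F \<xi> + q * z \<xi> * D \<xi> / a \<xi>) *\<^sub>R y \<xi>) \<le> (F1 + q * (D1 / a0)) * m"
      unfolding norm_scaleR m_def by (intro mult_right_mono) auto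
    moreover have "norm (lam * y \<xi>) = norm lam * m"
      by (simp add: norm_mult m_def)
    ultimately show ?thesis
      unfolding B3_def distrib_right[of _ "norm lam"] by (intro order_trans[OF norm_triangle_ineq]) simp
  qed
  moreover have "norm ((z \<xi> * D \<xi> / a \<xi>) *\<^sub>R (lam * p \<xi>)) \<le> B4 * n"
    unfolding B4_def n_def norm_scaleR norm_mult mult.assoc[of "D1 / a0"]
    using zD by (intro mult_right_mono) auto
  ultimately have "norm ((F \<xi> + q * z \<xi> * D \<xi> / a \<xi>) *\<^sub>R y \<xi> + lam * y \<xi> + (z \<xi> * D \<xi> / a \<xi>) *\<^sub>R (lam * p \<xi>))
      \<le> B3 * m + B4 * n"
    by (rule order_trans[OF norm_triangle_ineq add_mono])
  also have "\<dots> \<le> (B1 + B2 + B3 + B4) * m + (B1 + B2 + B3 + B4) * n"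
    using B nm by (intro add_mono mult_right_mono) auto
  finally show "norm ((F \<xi> + q * z \<xi> * D \<xi> / a \<xi>) *\<^sub>R y \<xi> + lam * y \<xi> + (z \<xi> * D \<xi> / a \<xi>) *\<^sub>R (lam * p \<xi>))
      \<le> (B1 + B2 + B3 + B4) * (norm (p \<xi>) + norm (y \<xi>))"
    by (simp add: n_def m_def distrib_left)
qed

text \<open>Gronwall in both directions for \<open>S = |p|\<^sup>2 + |y|\<^sup>2\<close>, where
  \<open>|S'| \<le> 4 B S\<close>. Monotonicity of \<open>S exp (- 4 B \<xi>)\<close> bounds
  \<open>S\<close>, hence the derivatives, near the shock, so the limits exist; monotonicity of
  \<open>S exp (4 B \<xi>)\<close> carries zero limits back to all \<open>\<xi> < 0\<close>.\<close>

lemma limits_at_0: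
  "\<exists>p0 y0. (p \<longlongrightarrow> p0) (at_left 0) \<and> (y \<longlongrightarrow> y0) (at_left 0) \<and>
    (p0 = 0 \<and> y0 = 0 \<longrightarrow> (\<forall>\<xi><0. p \<xi> = 0 \<and> y \<xi> = 0))"
proof -
  define p' where "p' = (\<lambda>\<xi>. - ((1 / a \<xi>) *\<^sub>R (lam * p \<xi>)) - (q * (1 + 1 / a \<xi>)) *\<^sub>R y \<xi>)"
  define y' where "y' = (\<lambda>\<xi>. (F \<xi> + q * z \<xi> * D \<xi> / a \<xi>) *\<^sub>R y \<xi> + lam * y \<xi> + (z \<xi> * D \<xi> / a \<xi>) *\<^sub>R (lam * p \<xi>))"
  obtain B where B: "0 \<le> B"
    and p': "\<And>\<xi>. \<xi> < 0 \<Longrightarrow> norm (p' \<xi>) \<le> B * (norm (p \<xi>) + norm (y \<xi>))"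
    and y': "\<And>\<xi>. \<xi> < 0 \<Longrightarrow> norm (y' \<xi>) \<le> B * (norm (p \<xi>) + norm (y \<xi>))"
    using derivative_bounds unfolding p'_def y'_def by blast
  have pd: "(p has_vector_derivative p' \<xi>) (at \<xi>)" if "\<xi> < 0" for \<xi>
    using p_deriv[OF that] by (simp only: p'_def)
  have yd: "(y has_vector_derivative y' \<xi>) (at \<xi>)" if "\<xi> < 0" for \<xi>
    using y_deriv[OF that] by (simp only: y'_def)
  define S where "S = (\<lambda>\<xi>. p \<xi> \<bullet> p \<xi> + y \<xi> \<bullet> y \<xi>)"
  define S' where "S' = (\<lambda>\<xi>. 2 * (p \<xi> \<bullet> p' \<xi> + y \<xi> \<bullet> y' \<xi>))"
  have Sd: "(S has_real_derivative S' \<xi>) (at \<xi>)" if "\<xi> < 0" for \<xi>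
    unfolding S_def S'_def
    by (rule DERIV_cong[OF DERIV_add[OF has_real_derivative_inner[OF pd[OF that] pd[OF that]]
          has_real_derivative_inner[OF yd[OF that] yd[OF that]]]])
      (simp add: inner_commute[of "p' \<xi>"] inner_commute[of "y' \<xi>"])
  have S_nonneg: "0 \<le> S \<xi>" for \<xi> by (simp add: S_def)
  have S_norm: "(norm (p \<xi>) + norm (y \<xi>))\<^sup>2 \<le> 2 * S \<xi>" for \<xi>
    using zero_le_power2[of "norm (p \<xi>) - norm (y \<xi>)"]
    by (simp add: S_def power2_norm_eq_inner[symmetric] power2_sum power2_diff)
  have S': "\<bar>S' \<xi>\<bar> \<le> 4 * B * S \<xi>" if "\<xi> < 0" for \<xi>
  proof -
    define k where "k = norm (p \<xi>) + norm (y \<xi>)"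
    have "\<bar>p \<xi> \<bullet> p' \<xi>\<bar> \<le> norm (p \<xi>) * (B * k)"
      using p'[OF that] unfolding k_def
      by (intro order_trans[OF Cauchy_Schwarz_ineq2] mult_left_mono) auto
    moreover have "\<bar>y \<xi> \<bullet> y' \<xi>\<bar> \<le> norm (y \<xi>) * (B * k)"
      using y'[OF that] unfolding k_def
      by (intro order_trans[OF Cauchy_Schwarz_ineq2] mult_left_mono) auto
    ultimately have "\<bar>p \<xi> \<bullet> p' \<xi> + y \<xi> \<bullet> y' \<xi>\<bar> \<le> norm (p \<xi>) * (B * k) + norm (y \<xi>) * (B * k)"
      by (rule order_trans[OF abs_triangle_ineq add_mono])
    then have "\<bar>S' \<xi>\<bar> \<le> 2 * (norm (p \<xi>) * (B * k) + norm (y \<xi>) * (B * k))"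
      by (simp add: S'_def abs_mult)
    also have "\<dots> = 2 * B * k\<^sup>2"
      by (simp add: k_def power2_eq_square algebra_simps)
    also have "\<dots> \<le> 2 * B * (2 * S \<xi>)"
      unfolding k_def using S_norm B by (intro mult_left_mono) auto
    finally show ?thesis by simp
  qed
  have exp_d: "((\<lambda>\<xi>. S \<xi> * exp (c * \<xi>)) has_real_derivative exp (c * \<xi>) * (S' \<xi> + c * S \<xi>)) (at \<xi>)"
    if "\<xi> < 0" for c \<xi>
    by (auto intro!: derivative_eq_intros Sd that simp: algebra_simps)
  \<comment> \<open>The starting point -1 is arbitrary; only a left neighbourhood of 0
    matters.\<close>
  define M where "M = S (-1) * exp (4 * B)"
  have S_le: "S \<xi> \<le> M" if "\<xi> \<in> {-1<..<0}" for \<xi>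
  proof -
    have "- (S (-1) * exp (- 4 * B * (-1))) \<le> - (S \<xi> * exp (- 4 * B * \<xi>))"
    proof (rule nondecreasing_below[where g = "\<lambda>\<xi>. - (S \<xi> * exp (- 4 * B * \<xi>))" and b = 0])
      fix x :: real assume x: "x < 0"
      show "((\<lambda>\<xi>. - (S \<xi> * exp (- 4 * B * \<xi>))) has_real_derivative - (exp (- 4 * B * x) * (S' x + - 4 * B * S x))) (at x)"
        by (intro DERIV_minus exp_d x)
      show "0 \<le> - (exp (- 4 * B * x) * (S' x + - 4 * B * S x))"
        using S'[OF x] by (simp add: mult_le_0_iff)
    qed (use that in auto)
    moreover have "S \<xi> * 1 \<le> S \<xi> * exp (- 4 * B * \<xi>)"
      using that B S_nonneg by (intro mult_left_mono) (auto simp: mult_nonneg_nonpos)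
    ultimately show ?thesis by (simp add: M_def)
  qed
  have bound: "B * (norm (p \<xi>) + norm (y \<xi>)) \<le> B * sqrt (2 * M)" if "\<xi> \<in> {-1<..<0}" for \<xi>
    using S_norm[of \<xi>] S_le[OF that] B by (intro mult_left_mono real_le_rsqrt) auto
  have "\<exists>l. (p \<longlongrightarrow> l) (at_left 0)"
    by (rule bounded_derivative_limit_at_left[where c = "-1" and g' = p' and B = "B * sqrt (2 * M)"])
      (auto intro!: pd order_trans[OF p' bound])
  moreover have "\<exists>l. (y \<longlongrightarrow> l) (at_left 0)"
    by (rule bounded_derivative_limit_at_left[where c = "-1" and g' = y' and B = "B * sqrt (2 * M)"])
      (auto intro!: yd order_trans[OF y' bound])
  moreover have "p \<xi> = 0 \<and> y \<xi> = 0"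
    if lim: "(p \<longlongrightarrow> 0) (at_left 0)" "(y \<longlongrightarrow> 0) (at_left 0)" and neg: "\<xi> < 0" for \<xi>
  proof -
    have "((\<lambda>\<xi>. S \<xi> * exp (4 * B * \<xi>)) \<longlongrightarrow> ((0::complex) \<bullet> 0 + (0::complex) \<bullet> 0) * exp (4 * B * 0)) (at_left 0)"
      unfolding S_def by (intro tendsto_intros lim)
    then have "((\<lambda>\<xi>. S \<xi> * exp (4 * B * \<xi>)) \<longlongrightarrow> 0) (at_left 0)"
      by simp
    moreover have "0 \<le> exp (4 * B * \<xi>) * (S' \<xi> + 4 * B * S \<xi>)" if "\<xi> < 0" for \<xi>
      using S'[OF that] by (intro mult_nonneg_nonneg) auto
    ultimately have "S \<xi> * exp (4 * B * \<xi>) \<le> 0"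
      using le_limit_at_left[where g = "\<lambda>\<xi>. S \<xi> * exp (4 * B * \<xi>)" and b = 0 and x = \<xi> and l = 0
          and g' = "\<lambda>\<xi>. exp (4 * B * \<xi>) * (S' \<xi> + 4 * B * S \<xi>)"] exp_d[where c = "4 * B"] neg
      by blast
    then have "S \<xi> = 0"
      using S_nonneg[of \<xi>] by (simp add: mult_le_0_iff)
    then show ?thesis
      unfolding S_def by (simp add: add_nonneg_eq_0_iff)
  qed
  ultimately show ?thesis by blast
qed

end

section \<open>The functional \<Phi>, and what it forces at the shock\<close>

context detonation_mode
begin

text \<open>For \<open>q = 0\<close> the equation of \<open>p\<close> decouples and
  \<open>|p|\<close> cannot increase; its limit at -infinity is 0.\<close>

lemma p_zero_if_no_heat:
  assumes "q = 0" "\<xi> < 0"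
  shows "p \<xi> = 0"
proof -
  have "0 \<le> - (p \<xi> \<bullet> p \<xi>)"
  proof (rule limit_at_bot_le[where g = "\<lambda>\<xi>. - (p \<xi> \<bullet> p \<xi>)" and b = 0
        and g' = "\<lambda>\<xi>. 2 * Re lam / a \<xi> * (p \<xi> \<bullet> p \<xi>)"])
    fix x :: real assume x: "x < 0"
    show "((\<lambda>\<xi>. - (p \<xi> \<bullet> p \<xi>)) has_real_derivative 2 * Re lam / a x * (p x \<bullet> p x)) (at x)"
      by (rule DERIV_cong[OF DERIV_minus[OF has_real_derivative_inner[OF p_deriv[OF x] p_deriv[OF x]]]])
        (simp add: inner_simps inner_mult_self inner_commute[of "lam * p x" "p x"] assms(1))
    show "0 \<le> 2 * Re lam / a x * (p x \<bullet> p x)"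
      using Re_lam a_bounds[OF x] by simp
  next
    have "((\<lambda>\<xi>. - (p \<xi> \<bullet> p \<xi>)) \<longlongrightarrow> - ((0::complex) \<bullet> 0)) at_bot"
      by (intro tendsto_intros p_bot)
    then show "((\<lambda>\<xi>. - (p \<xi> \<bullet> p \<xi>)) \<longlongrightarrow> 0) at_bot" by simp
  qed (fact assms)
  moreover have "0 \<le> p \<xi> \<bullet> p \<xi>" by simp
  ultimately have "p \<xi> \<bullet> p \<xi> = 0" by linarith
  then show ?thesis by simp
qed

definition \<kappa> :: real where "\<kappa> = Re (inverse lam)"

lemma kappa_pos: "0 < \<kappa>"
proof -
  have "lam \<noteq> 0" using Re_lam by auto
  then show ?thesis
    using Re_lam by (simp add: \<kappa>_def cmod_power2[symmetric])
qed

definition \<Phi> :: "real \<Rightarrow> real" where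
  "\<Phi> \<xi> = - ((inverse lam * R \<xi>) \<bullet> P \<xi>) - (P \<xi> \<bullet> P \<xi>) / (2 * \<gamma> \<xi>) - \<kappa> * (P \<xi> \<bullet> P \<xi>) / f \<xi>"

text \<open>\<open>R\<close> is bounded and \<open>P\<close> is of order \<open>z\<close>, so the
  first and last terms vanish with \<open>z\<close>. In the middle term \<open>|P|\<^sup>2\<close>
  is of order \<open>z\<^sup>2\<close>, which beats the single factor \<open>z\<close> in
  \<gamma>.\<close>

lemma \<Phi>_bot:
  assumes "0 < q"
  shows "(\<Phi> \<longlongrightarrow> 0) at_bot"
proof -
  obtain M c \<Xi> where c: "0 \<le> c" and Xi: "\<Xi> < 0"
    and R: "\<And>\<xi>. \<xi> < \<Xi> \<Longrightarrow> norm (R \<xi>) \<le> M"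
    and P: "\<And>\<xi>. \<xi> < \<Xi> \<Longrightarrow> norm (P \<xi>) \<le> c * (F \<xi> * z \<xi>) * norm (R \<xi>)"
    using R_bounded by blast
  have M: "0 \<le> M" using order_trans[OF norm_ge_zero R[of "\<Xi> - 1"]] by simp
  define N where "N = c * F1 * M"
  define C where "C = norm (inverse lam) * M * N + c * M * N / (2 * q) + \<kappa> * N\<^sup>2 * 2"
  have "\<bar>\<Phi> \<xi>\<bar> \<le> C * z \<xi>" if "\<xi> < \<Xi>" for \<xi>
  proof -
    have neg: "\<xi> < 0" using that Xi by simp
    note pos = F_pos[OF neg] z_pos[OF neg]
    have P1: "norm (P \<xi>) \<le> c * (F \<xi> * z \<xi>) * M"
      using P[OF that] R[OF that] pos c by (elim order_trans) (intro mult_left_mono, auto)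
    also have "\<dots> \<le> c * (F1 * z \<xi>) * M"
      using F_le[OF neg] pos c M by (intro mult_right_mono mult_left_mono) auto
    finally have P2: "norm (P \<xi>) \<le> N * z \<xi>"
      by (simp add: N_def ac_simps)
    have N: "0 \<le> N * z \<xi>" using order_trans[OF norm_ge_zero P2] .
    have "\<bar>(inverse lam * R \<xi>) \<bullet> P \<xi>\<bar> \<le> (norm (inverse lam) * norm (R \<xi>)) * norm (P \<xi>)"
      using Cauchy_Schwarz_ineq2[of "inverse lam * R \<xi>" "P \<xi>"] unfolding norm_mult .
    also have "\<dots> \<le> (norm (inverse lam) * M) * (N * z \<xi>)"
      using R[OF that] P2 M by (intro mult_mono) auto
    finally have 1: "\<bar>(inverse lam * R \<xi>) \<bullet> P \<xi>\<bar> \<le> norm (inverse lam) * M * N * z \<xi>"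
      by (simp only: mult.assoc)
    \<comment> \<open>One factor \<open>|P|\<close> is bounded by a multiple of \<open>F z\<close>,
      to cancel \<gamma>, the other by a multiple of \<open>z\<close>, to supply the decay.\<close>
    have PP: "P \<xi> \<bullet> P \<xi> \<le> (c * (F \<xi> * z \<xi>) * M) * (N * z \<xi>)"
      using P1 P2 order_trans[OF norm_ge_zero P1]
      by (simp only: power2_norm_eq_inner[symmetric] power2_eq_square) (intro mult_mono, auto)
    have "(P \<xi> \<bullet> P \<xi>) / (2 * \<gamma> \<xi>) \<le> (c * (F \<xi> * z \<xi>) * M) * (N * z \<xi>) / (2 * \<gamma> \<xi>)"
      using PP pos assms by (intro divide_right_mono) (auto simp: \<gamma>_def)
    also have "\<dots> = c * M * N / (2 * q) * z \<xi>"
      using pos assms by (simp add: \<gamma>_def field_simps)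
    finally have 2: "\<bar>(P \<xi> \<bullet> P \<xi>) / (2 * \<gamma> \<xi>)\<bar> \<le> c * M * N / (2 * q) * z \<xi>"
      using pos assms by (simp add: \<gamma>_def)
    have "P \<xi> \<bullet> P \<xi> \<le> (N * z \<xi>) * (N * z \<xi>)"
      using P2 N by (simp only: power2_norm_eq_inner[symmetric] power2_eq_square) (intro mult_mono, auto)
    also have "\<dots> \<le> N\<^sup>2 * z \<xi>"
      using pos z_le[OF neg] mult_left_mono[of "z \<xi> * z \<xi>" "z \<xi>" "N\<^sup>2"]
      by (simp add: power2_eq_square ac_simps mult_left_le)
    finally have "\<kappa> * (P \<xi> \<bullet> P \<xi>) / f \<xi> \<le> \<kappa> * (N\<^sup>2 * z \<xi>) / (1 / 2)"
      using kappa_pos f_ge[OF neg] pos by (intro frac_le mult_left_mono) auto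
    then have 3: "\<bar>\<kappa> * (P \<xi> \<bullet> P \<xi>) / f \<xi>\<bar> \<le> \<kappa> * N\<^sup>2 * 2 * z \<xi>"
      using kappa_pos f_ge[OF neg] by simp
    have "C * z \<xi> = norm (inverse lam) * M * N * z \<xi> + c * M * N / (2 * q) * z \<xi> + \<kappa> * N\<^sup>2 * 2 * z \<xi>"
      unfolding C_def by (simp only: distrib_right)
    moreover have "\<bar>- r - t - w\<bar> \<le> A + B + E" if "\<bar>r\<bar> \<le> A" "\<bar>t\<bar> \<le> B" "\<bar>w\<bar> \<le> E" for r t w A B E :: real
      using that by linarith
    ultimately show ?thesis
      using 1 2 3 unfolding \<Phi>_def by presburger
  qed
  then have "\<forall>\<^sub>F \<xi> in at_bot. norm (\<Phi> \<xi>) \<le> C * z \<xi>"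
    by (intro eventually_mono[OF eventually_gt_at_bot[of \<Xi>]]) simp
  moreover have "((\<lambda>\<xi>. C * z \<xi>) \<longlongrightarrow> 0) at_bot"
    using tendsto_mult_left[OF z_bot, of C] by simp
  ultimately show ?thesis
    by (rule Lim_null_comparison)
qed

text \<open>
  The square arises from \<open>X \<bullet> (R / lam + P / \<gamma>) = \<kappa> |X|\<^sup>2 / \<gamma>\<close> and \<open>P' = - (1 + 1 / a) X\<close>.
\<close>

definition \<Phi>' :: "real \<Rightarrow> real" where
  "\<Phi>' \<xi> = (1 + 1 / a \<xi>) * \<kappa> / \<gamma> \<xi> * ((X \<xi> + (\<gamma> \<xi> / f \<xi>) *\<^sub>R P \<xi>) \<bullet> (X \<xi> + (\<gamma> \<xi> / f \<xi>) *\<^sub>R P \<xi>))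
     + (F \<xi> / \<gamma> \<xi> - h \<xi>) * (P \<xi> \<bullet> P \<xi>) / 2"

text \<open>The first term is a square with positive weight. In the second, \<open>growth\<close>
  enters as \<open>h \<le> 1 / (q z) = F / \<gamma>\<close>.\<close>

lemma \<Phi>'_nonneg:
  assumes "0 < q" and neg: "\<xi> < 0"
  shows "0 \<le> \<Phi>' \<xi>"
proof -
  note pos = F_pos[OF neg] z_pos[OF neg] a_bounds(3)[OF neg]
  have "D \<xi> * (q * z \<xi>) \<le> 1 * (F \<xi> * a \<xi>)"
    using growth[OF neg] by (simp add: a_def ac_simps)
  then have "h \<xi> \<le> 1 / (q * z \<xi>)"
    using pos assms(1) unfolding h_def by (simp add: divide_simps)
  moreover have "F \<xi> / \<gamma> \<xi> = 1 / (q * z \<xi>)"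
    using pos by (simp add: \<gamma>_def)
  moreover have "0 < \<gamma> \<xi>" using pos assms(1) by (simp add: \<gamma>_def)
  ultimately show ?thesis
    unfolding \<Phi>'_def using pos kappa_pos by (intro add_nonneg_nonneg) auto
qed

text \<open>The first term of \<Phi> produces \<open>|X|\<^sup>2\<close> and a multiple of
  \<open>X \<bullet> P\<close>; the latter cancels against the derivative of
  \<open>|P|\<^sup>2 / (2 \<gamma>)\<close>. The term with \<open>f\<close> then completes the
  square, because \<open>f' = (1 + 1 / a) \<gamma>\<close>.\<close>

lemma \<Phi>_deriv:
  assumes "0 < q" and neg: "\<xi> < 0"
  shows "(\<Phi> has_real_derivative \<Phi>' \<xi>) (at \<xi>)"
proof -
  note pos = F_pos[OF neg] z_pos[OF neg] a_bounds(3)[OF neg]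
  define b where "b = 1 + 1 / a \<xi>"
  have g: "\<gamma> \<xi> \<noteq> 0" using pos assms(1) by (simp add: \<gamma>_def)
  have f: "f \<xi> \<noteq> 0" using f_ge[OF neg] by simp
  have lam: "lam \<noteq> 0" using Re_lam by auto
  have gd: "(\<gamma> has_real_derivative \<gamma> \<xi> * (\<gamma> \<xi> * h \<xi> + F \<xi>)) (at \<xi>)"
    unfolding \<gamma>_def[abs_def] h_def
    by (rule DERIV_cong[OF DERIV_mult[OF DERIV_cmult[OF F_deriv[OF neg]] z_deriv[OF neg]]])
      (use pos in \<open>simp add: field_simps a_def[symmetric]\<close>)
  have ud: "(u has_real_derivative \<gamma> \<xi> / a \<xi>) (at \<xi>)"
    using u_deriv[OF neg] by (simp add: \<gamma>_def a_def)
  \<comment> \<open>The flux derivative \<open>\<omega> u + (1 - \<omega>)\<close> equals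
    \<open>a + 1\<close>, whence the same factor \<open>b\<close> as in \<open>P'\<close>.\<close>
  have "(f has_real_derivative (\<omega> * u \<xi> + (1 - \<omega>)) * (\<gamma> \<xi> / a \<xi>)) (at \<xi>)"
    unfolding f_def[abs_def]
    by (rule DERIV_cong[OF DERIV_add[OF DERIV_cdivide[OF DERIV_cmult[OF DERIV_power[OF ud]]] DERIV_cmult[OF ud]]])
      (simp add: algebra_simps add_divide_distrib diff_divide_distrib)
  moreover have "(\<omega> * u \<xi> + (1 - \<omega>)) * (\<gamma> \<xi> / a \<xi>) = b * \<gamma> \<xi>"
  proof -
    have "\<omega> * u \<xi> + (1 - \<omega>) = a \<xi> + 1"
      by (simp add: a_def algebra_simps)
    then show ?thesis
      using pos by (simp add: b_def field_simps)
  qed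
  ultimately have fd: "(f has_real_derivative b * \<gamma> \<xi>) (at \<xi>)" by simp
  have PP: "((\<lambda>\<xi>. P \<xi> \<bullet> P \<xi>) has_real_derivative - 2 * b * (X \<xi> \<bullet> P \<xi>)) (at \<xi>)"
    by (rule DERIV_cong[OF has_real_derivative_inner[OF P_deriv[OF neg] P_deriv[OF neg]]])
      (simp add: b_def inner_commute[of "P \<xi>" "X \<xi>"] algebra_simps)
  have "((\<lambda>\<xi>. inverse lam * R \<xi>) has_vector_derivative inverse lam * (h \<xi> *\<^sub>R (lam * P \<xi>))) (at \<xi>)"
    by (rule has_vector_derivative_mult_right[OF R_deriv[OF neg]])
  then have lR: "((\<lambda>\<xi>. inverse lam * R \<xi>) has_vector_derivative h \<xi> *\<^sub>R P \<xi>) (at \<xi>)"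
    using lam by (simp flip: mult.assoc)
  have RP: "((\<lambda>\<xi>. (inverse lam * R \<xi>) \<bullet> P \<xi>) has_real_derivative
      - b * ((inverse lam * R \<xi>) \<bullet> X \<xi>) + h \<xi> * (P \<xi> \<bullet> P \<xi>)) (at \<xi>)"
    by (rule DERIV_cong[OF has_real_derivative_inner[OF lR P_deriv[OF neg]]]) (simp add: b_def algebra_simps)
  have 2: "((\<lambda>\<xi>. (P \<xi> \<bullet> P \<xi>) / (2 * \<gamma> \<xi>)) has_real_derivative
      - b * (X \<xi> \<bullet> P \<xi>) / \<gamma> \<xi> - (P \<xi> \<bullet> P \<xi>) * (\<gamma> \<xi> * h \<xi> + F \<xi>) / (2 * \<gamma> \<xi>)) (at \<xi>)"
    by (rule DERIV_cong[OF DERIV_divide[OF PP DERIV_cmult[OF gd]]])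
      (use g in \<open>simp_all add: field_simps power2_eq_square\<close>)
  have 3: "((\<lambda>\<xi>. \<kappa> * (P \<xi> \<bullet> P \<xi>) / f \<xi>) has_real_derivative
      - 2 * \<kappa> * b * (X \<xi> \<bullet> P \<xi>) / f \<xi> - \<kappa> * (P \<xi> \<bullet> P \<xi>) * (b * \<gamma> \<xi>) / (f \<xi>)\<^sup>2) (at \<xi>)"
    by (rule DERIV_cong[OF DERIV_divide[OF DERIV_cmult[OF PP] fd f]])
      (use f in \<open>simp add: field_simps power2_eq_square\<close>)
  have "inverse lam * X \<xi> = P \<xi> + \<gamma> \<xi> *\<^sub>R (inverse lam * R \<xi>)"
    using lam by (simp add: X_def algebra_simps)
  then have "\<kappa> * (X \<xi> \<bullet> X \<xi>) = X \<xi> \<bullet> P \<xi> + \<gamma> \<xi> * ((inverse lam * R \<xi>) \<bullet> X \<xi>)"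
    using inner_mult_self[of "X \<xi>" "inverse lam"]
    by (simp add: \<kappa>_def inner_add_right inner_commute[of "X \<xi>" "inverse lam * R \<xi>"] del: inverse_complex.sel)
  then have lRX: "(inverse lam * R \<xi>) \<bullet> X \<xi> = (\<kappa> * (X \<xi> \<bullet> X \<xi>) - X \<xi> \<bullet> P \<xi>) / \<gamma> \<xi>"
    using g by (simp add: field_simps)
  show ?thesis
    unfolding \<Phi>_def[abs_def]
  proof (rule DERIV_cong[OF DERIV_diff[OF DERIV_diff[OF DERIV_minus[OF RP] 2] 3]])
    have sq: "(X \<xi> + c *\<^sub>R P \<xi>) \<bullet> (X \<xi> + c *\<^sub>R P \<xi>)
      = X \<xi> \<bullet> X \<xi> + 2 * c * (X \<xi> \<bullet> P \<xi>) + c\<^sup>2 * (P \<xi> \<bullet> P \<xi>)" for c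
      by (simp add: inner_add_left inner_add_right inner_commute[of "P \<xi>" "X \<xi>"] power2_eq_square algebra_simps)
    show "- (- b * ((inverse lam * R \<xi>) \<bullet> X \<xi>) + h \<xi> * (P \<xi> \<bullet> P \<xi>)) -
      (- b * (X \<xi> \<bullet> P \<xi>) / \<gamma> \<xi> - (P \<xi> \<bullet> P \<xi>) * (\<gamma> \<xi> * h \<xi> + F \<xi>) / (2 * \<gamma> \<xi>)) -
      (- 2 * \<kappa> * b * (X \<xi> \<bullet> P \<xi>) / f \<xi> - \<kappa> * (P \<xi> \<bullet> P \<xi>) * (b * \<gamma> \<xi>) / (f \<xi>)\<^sup>2) = \<Phi>' \<xi>"
      unfolding \<Phi>'_def sq lRX b_def[symmetric] using g f
      by (simp add: field_simps power2_eq_square)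
  qed
qed

lemma boundary_values_zero:
  assumes p0: "(p \<longlongrightarrow> p0) (at_left 0)" and y0: "(y \<longlongrightarrow> y0) (at_left 0)"
    and zero: "2 * y0 + of_real Fs * p0 = 0"
  shows "p0 = 0 \<and> y0 = 0"
proof -
  have p0_zero: "p0 = 0"
  proof (cases "q = 0")
    case True
    have "\<forall>\<^sub>F \<xi> in at_left 0. p \<xi> = 0"
      using eventually_at_left_real[of "-1" 0] by (auto elim!: eventually_mono intro: p_zero_if_no_heat[OF True])
    then have "(p \<longlongrightarrow> 0) (at_left 0)"
      by (rule tendsto_eventually)
    then show ?thesis
      using tendsto_unique[OF _ p0] by simp
  next
    case False
    then have q_pos: "0 < q" using q by simp
    have e: "((\<lambda>\<xi>. exp (- lam * of_real \<xi>)) \<longlongrightarrow> exp (- lam * of_real 0)) (at_left 0)"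
      by (intro tendsto_intros)
    have "(P \<longlongrightarrow> exp (- lam * of_real 0) * p0) (at_left 0)"
      unfolding P_def by (intro tendsto_intros e p0)
    then have P0: "(P \<longlongrightarrow> p0) (at_left 0)" by simp
    \<comment> \<open>At the shock \<open>z = 1\<close> and the exponential is 1, so the root
      condition reads \<open>R = - P / 2\<close>.\<close>
    have y0_eq: "y0 = Fs *\<^sub>R (- (1 / 2) *\<^sub>R p0)"
      using zero by (simp add: scaleR_conv_of_real field_simps eq_neg_iff_add_eq_0)
    have "(R \<longlongrightarrow> (1 / (Fs * 1)) *\<^sub>R (exp (- lam * of_real 0) * y0)) (at_left 0)"
      unfolding R_def using Fs_pos by (intro tendsto_intros e y0 F_0 z_0) auto
    then have R0: "(R \<longlongrightarrow> - (1 / 2) *\<^sub>R p0) (at_left 0)"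
      using Fs_pos by (simp add: y0_eq)
    have "(\<Phi> \<longlongrightarrow> - ((inverse lam * (- (1 / 2) *\<^sub>R p0)) \<bullet> p0) - (p0 \<bullet> p0) / (2 * (q * Fs * 1))
        - \<kappa> * (p0 \<bullet> p0) / 2) (at_left 0)"
      unfolding \<Phi>_def \<gamma>_def using Fs_pos q_pos by (intro tendsto_intros R0 P0 F_0 z_0 f_0) auto
    \<comment> \<open>Since \<open>f = 2\<close> at the shock, the term in \<open>R\<close> and the
      term in \<kappa> cancel exactly.\<close>
    moreover have "(inverse lam * (- (1 / 2) *\<^sub>R p0)) \<bullet> p0 = - (1 / 2) * (\<kappa> * (p0 \<bullet> p0))"
      using inner_mult_self[of p0 "inverse lam"] inner_commute[of p0 "inverse lam * p0"] by (simp add: \<kappa>_def del: inverse_complex.sel)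
    ultimately have "(\<Phi> \<longlongrightarrow> - ((p0 \<bullet> p0) / (2 * (q * Fs)))) (at_left 0)"
      by simp
    moreover have "0 \<le> \<Phi> \<xi>" if "\<xi> < 0" for \<xi>
      using limit_at_bot_le[where g = \<Phi> and g' = \<Phi>' and b = 0 and l = 0]
        \<Phi>_deriv[OF q_pos] \<Phi>'_nonneg[OF q_pos] \<Phi>_bot[OF q_pos] that by blast
    then have "\<forall>\<^sub>F \<xi> in at_left 0. 0 \<le> \<Phi> \<xi>"
      using eventually_at_left_real[of "-1" 0] by (auto elim!: eventually_mono)
    ultimately have "0 \<le> - ((p0 \<bullet> p0) / (2 * (q * Fs)))"
      by (rule tendsto_lowerbound) simp
    moreover have "0 < p0 \<bullet> p0 / (2 * (q * Fs))" if "p0 \<noteq> 0"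
      using that q_pos Fs_pos by simp
    ultimately show ?thesis by fastforce
  qed
  with zero show ?thesis by simp
qed

end

section \<open>The Evans-Lopatinsky determinant\<close>

lemma tendsto_vec2:
  fixes l :: "'a::topological_space^2"
  assumes "((\<lambda>x. f x $ 1) \<longlongrightarrow> l $ 1) G" "((\<lambda>x. f x $ 2) \<longlongrightarrow> l $ 2) G"
  shows "(f \<longlongrightarrow> l) G"
proof (rule vec_tendstoI)
  show "((\<lambda>x. f x $ i) \<longlongrightarrow> l $ i) G" for i
    using assms exhaust_2[of i] by auto
qed

lemma exp_decaying_at_bot_tendsto:
  assumes "exp_decaying_at_bot v"
  shows "((\<lambda>\<xi>. v \<xi> $ i) \<longlongrightarrow> 0) at_bot"
proof -
  obtain C \<eta> where eta: "0 < \<eta>" and ev: "\<forall>\<^sub>F \<xi> in at_bot. norm (v \<xi>) \<le> C * exp (\<eta> * \<xi>)"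
    using assms unfolding exp_decaying_at_bot_def by blast
  have "\<forall>\<^sub>F \<xi> in at_bot. norm (v \<xi> $ i) \<le> C * exp (\<eta> * \<xi>)"
    using ev by eventually_elim (rule order_trans[OF Finite_Cartesian_Product.norm_nth_le])
  moreover have "filterlim (\<lambda>\<xi>. \<eta> * \<xi>) at_bot at_bot"
    by (rule filterlim_tendsto_pos_mult_at_bot[OF tendsto_const eta filterlim_ident])
  then have "((\<lambda>\<xi>. exp (\<eta> * \<xi>)) \<longlongrightarrow> 0) at_bot"
    by (rule filterlim_compose[OF exp_at_bot])
  then have "((\<lambda>\<xi>. C * exp (\<eta> * \<xi>)) \<longlongrightarrow> 0) at_bot"
    by (rule tendsto_mult_right_zero)
  ultimately show ?thesis
    by (rule Lim_null_comparison)
qed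

context detonation_profile
begin

text \<open>The interior equation differentiates \<open>a v\<^sub>1\<close> rather than
  \<open>v\<^sub>1\<close>, so the first row stays in conservative form; in the second row
  \<open>matA\<close> is just a sign, which is undone.\<close>

lemma interior_solution_components:
  assumes F: "\<And>\<xi>. F \<xi> = \<phi> (u \<xi>)" and D: "\<And>\<xi>. D \<xi> = deriv \<phi> (u \<xi>)"
    and sol: "interior_solution \<omega> q \<phi> u z lam w" and neg: "\<xi> < 0"
  shows "((\<lambda>\<xi>. of_real (a \<xi>) * w \<xi> $ 1) has_vector_derivative
      (of_real (q * z \<xi> * D \<xi>) - lam) * w \<xi> $ 1 + of_real (q * F \<xi>) * w \<xi> $ 2) (at \<xi>)"
    and "((\<lambda>\<xi>. w \<xi> $ 2) has_vector_derivative
      of_real (z \<xi> * D \<xi>) * w \<xi> $ 1 + (of_real (F \<xi>) + lam) * w \<xi> $ 2) (at \<xi>)"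
proof -
  have d: "((\<lambda>\<xi>. matA \<omega> u \<xi> *v w \<xi>) has_vector_derivative (matE q \<phi> u z \<xi> - mat lam) *v w \<xi>) (at \<xi>)"
    using sol neg unfolding interior_solution_def by blast
  note c = bounded_linear.has_vector_derivative[OF bounded_linear_vec_nth d]
  show "((\<lambda>\<xi>. of_real (a \<xi>) * w \<xi> $ 1) has_vector_derivative
      (of_real (q * z \<xi> * D \<xi>) - lam) * w \<xi> $ 1 + of_real (q * F \<xi>) * w \<xi> $ 2) (at \<xi>)"
    using c[of 1] by (simp add: matA_def matE_def matrix_vector_mult_def sum_2 mat_def a_def F D)
  have "(\<lambda>\<xi>. (matA \<omega> u \<xi> *v w \<xi>) $ 2) = (\<lambda>\<xi>. - w \<xi> $ 2)"
    by (simp add: matA_def matrix_vector_mult_def sum_2)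
  moreover have "((matE q \<phi> u z \<xi> - mat lam) *v w \<xi>) $ 2
      = - (of_real (z \<xi> * D \<xi>) * w \<xi> $ 1 + (of_real (F \<xi>) + lam) * w \<xi> $ 2)"
    by (simp add: matE_def matrix_vector_mult_def sum_2 mat_def F D algebra_simps)
  ultimately have "((\<lambda>\<xi>. - w \<xi> $ 2) has_vector_derivative
      - (of_real (z \<xi> * D \<xi>) * w \<xi> $ 1 + (of_real (F \<xi>) + lam) * w \<xi> $ 2)) (at \<xi>)"
    using c[of 2] by simp
  from has_vector_derivative_minus[OF this]
  show "((\<lambda>\<xi>. w \<xi> $ 2) has_vector_derivative
      of_real (z \<xi> * D \<xi>) * w \<xi> $ 1 + (of_real (F \<xi>) + lam) * w \<xi> $ 2) (at \<xi>)"
    by (simp add: algebra_simps)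
qed

text \<open>Because \<open>z\<close> is continuous across the shock and the state ahead does not
  react, the jump is \<open>(- 2 lam + q Fs, - Fs)\<close>; at \<open>u = 2\<close> the matrix
  \<open>matA\<close> is diagonal with entries \<omega> and -1.\<close>

lemma evans_lopatinsky_eq:
  assumes F: "\<And>\<xi>. F \<xi> = \<phi> (u \<xi>)" and "\<phi> 0 = 0"
    and ahead: "\<And>\<xi>. 0 < \<xi> \<Longrightarrow> u \<xi> = 0 \<and> z \<xi> = 1"
    and v: "(v lam \<longlongrightarrow> l) (at_left 0)"
  shows "evans_lopatinsky \<omega> q \<phi> u z v lam
    = 2 * lam * l $ 2 + of_real Fs * (of_real \<omega> * l $ 1 - of_real q * l $ 2)"
proof -
  define J where "J = (\<lambda>\<xi>. lam *s vecW u z \<xi> - vecR q \<phi> u z \<xi>)"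
  have "(J \<longlongrightarrow> vector [0, lam]) (at_right 0)"
  proof (rule tendsto_eventually)
    have "J \<xi> = vector [0, lam]" if "0 < \<xi>" for \<xi>
      using ahead[OF that] assms(2) unfolding J_def vecW_def vecR_def
      by (simp add: vec_eq_iff forall_2)
    then show "\<forall>\<^sub>F \<xi> in at_right 0. J \<xi> = vector [0, lam]"
      by (rule eventually_mono[OF eventually_at_right_less])
  qed
  then have J_right: "Lim (at_right 0) J = vector [0, lam]"
    by (intro tendsto_Lim) simp_all
  define Jl :: "complex^2" where "Jl = vector [2 * lam - of_real (q * Fs), lam + of_real Fs]"
  have "(J \<longlongrightarrow> Jl) (at_left 0)"
  proof (rule tendsto_vec2)
    have "((\<lambda>\<xi>. lam * of_real (u \<xi>) - of_real (q * F \<xi> * z \<xi>)) \<longlongrightarrow> lam * of_real 2 - of_real (q * Fs * 1)) (at_left 0)"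
      by (intro tendsto_intros u_0 z_0 F_0)
    then show "((\<lambda>\<xi>. J \<xi> $ 1) \<longlongrightarrow> Jl $ 1) (at_left 0)"
      by (simp add: J_def vecW_def vecR_def Jl_def F mult.commute[of lam])
    have "((\<lambda>\<xi>. lam * of_real (z \<xi>) - of_real (- F \<xi> * z \<xi>)) \<longlongrightarrow> lam * of_real 1 - of_real (- Fs * 1)) (at_left 0)"
      by (intro tendsto_intros z_0 F_0)
    then show "((\<lambda>\<xi>. J \<xi> $ 2) \<longlongrightarrow> Jl $ 2) (at_left 0)"
      by (simp add: J_def vecW_def vecR_def Jl_def F)
  qed
  then have J_left: "Lim (at_left 0) J = Jl"
    by (intro tendsto_Lim) simp_all
  have "(matA \<omega> u \<longlongrightarrow> vector [vector [of_real (\<omega> * (2 - 1)), 0], vector [0, -1]]) (at_left 0)"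
  proof (intro tendsto_vec2)
  qed (auto simp: matA_def intro!: tendsto_eq_intros u_0)
  then have A: "Lim (at_left 0) (matA \<omega> u) = vector [vector [of_real \<omega>, 0], vector [0, -1]]"
    by (intro tendsto_Lim) simp_all
  have "Lim (at_left 0) (v lam) = l"
    using v by (intro tendsto_Lim) simp_all
  then show ?thesis
    unfolding evans_lopatinsky_def jump_def J_def[symmetric] J_right J_left A
    by (simp add: Jl_def det_2 transpose_def matrix_vector_mult_def sum_2 algebra_simps)
qed

lemma evans_lopatinsky_nonzero:
  assumes F: "\<And>\<xi>. F \<xi> = \<phi> (u \<xi>)" and D: "\<And>\<xi>. D \<xi> = deriv \<phi> (u \<xi>)" and "\<phi> 0 = 0"
    and ahead: "\<And>\<xi>. 0 < \<xi> \<Longrightarrow> u \<xi> = 0 \<and> z \<xi> = 1"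
    and v: "decaying_mode \<omega> q \<phi> u z v" and Re_lam: "0 < Re lam"
  shows "evans_lopatinsky \<omega> q \<phi> u z v lam \<noteq> 0"
proof
  assume zero: "evans_lopatinsky \<omega> q \<phi> u z v lam = 0"
  have lam: "lam \<noteq> 0" using Re_lam by auto
  obtain N where "{lam. 0 \<le> Re lam} \<subseteq> N" "\<forall>lam\<in>N. interior_solution \<omega> q \<phi> u z lam (v lam)"
    and mode: "\<forall>lam. 0 \<le> Re lam \<longrightarrow> exp_decaying_at_bot (v lam) \<and> (\<exists>\<xi><0. v lam \<xi> \<noteq> 0)"
    using v unfolding decaying_mode_def by (elim conjE exE)
  then have sol: "interior_solution \<omega> q \<phi> u z lam (v lam)"
    using Re_lam by (simp add: subset_eq)
  have dec: "exp_decaying_at_bot (v lam)" and nontrivial: "\<exists>\<xi><0. v lam \<xi> \<noteq> 0"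
    using mode Re_lam by simp_all
  define y where "y = (\<lambda>\<xi>. v lam \<xi> $ 2)"
  define p where "p = (\<lambda>\<xi>. (of_real (a \<xi>) * v lam \<xi> $ 1 - of_real q * v lam \<xi> $ 2) * inverse lam)"
  have v1: "v lam \<xi> $ 1 = (lam * p \<xi> + of_real q * y \<xi>) / of_real (a \<xi>)" if "\<xi> < 0" for \<xi>
    using a_bounds(3)[OF that] lam by (simp add: p_def y_def field_simps)
  have bot: "((\<lambda>\<xi>. v lam \<xi> $ i) \<longlongrightarrow> 0) at_bot" for i
    by (rule exp_decaying_at_bot_tendsto[OF dec])
  interpret detonation_mode \<omega> q u0 F0 F1 D1 Fs u z F D lam p y
  proof unfold_locales
    show "0 < Re lam" by fact
    show "(y \<longlongrightarrow> 0) at_bot" unfolding y_def by (rule bot)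
    have "norm (of_real (a \<xi>) * v lam \<xi> $ 1) \<le> norm (v lam \<xi> $ 1)" if "\<xi> < 0" for \<xi>
      using a_bounds[OF that] by (simp add: norm_mult mult_left_le_one_le)
    then have "\<forall>\<^sub>F \<xi> in at_bot. norm (of_real (a \<xi>) * v lam \<xi> $ 1) \<le> norm (v lam \<xi> $ 1)"
      by (rule eventually_mono[OF eventually_gt_at_bot])
    then have "((\<lambda>\<xi>. of_real (a \<xi>) * v lam \<xi> $ 1) \<longlongrightarrow> 0) at_bot"
      by (rule Lim_null_comparison) (rule tendsto_norm_zero[OF bot])
    then have "(p \<longlongrightarrow> (0 - of_real q * 0) * inverse lam) at_bot"
      unfolding p_def by (intro tendsto_intros bot)
    then show "(p \<longlongrightarrow> 0) at_bot" by simp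
  next
    fix \<xi> :: real assume neg: "\<xi> < 0"
    note c = interior_solution_components[OF F D sol neg]
    have nz: "of_real (a \<xi>) \<noteq> (0::complex)" using a_bounds(3)[OF neg] by simp
    show "(y has_vector_derivative
      (F \<xi> + q * z \<xi> * D \<xi> / a \<xi>) *\<^sub>R y \<xi> + lam * y \<xi> + (z \<xi> * D \<xi> / a \<xi>) *\<^sub>R (lam * p \<xi>)) (at \<xi>)"
      using c(2) unfolding y_def[symmetric] v1[OF neg]
      by (rule has_vector_derivative_eq_rhs) (use nz in \<open>simp add: scaleR_conv_of_real field_simps y_def\<close>)
    \<comment> \<open>Subtracting \<open>q\<close> times the second equation removes all reaction
      terms from the first; a multiple of \<open>lam\<close> is left.\<close>
    have "(p has_vector_derivative - (v lam \<xi> $ 1) - of_real q * y \<xi>) (at \<xi>)"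
      unfolding p_def
      by (rule has_vector_derivative_eq_rhs[OF has_vector_derivative_mult_left[OF has_vector_derivative_diff[OF c(1)
            has_vector_derivative_mult_right[OF c(2)]]]])
        (use lam in \<open>simp add: y_def field_simps\<close>)
    then show "(p has_vector_derivative
      - ((1 / a \<xi>) *\<^sub>R (lam * p \<xi>)) - (q * (1 + 1 / a \<xi>)) *\<^sub>R y \<xi>) (at \<xi>)"
      unfolding v1[OF neg]
      by (rule has_vector_derivative_eq_rhs) (use nz in \<open>simp add: scaleR_conv_of_real field_simps\<close>)
  qed
  obtain p0 y0 where p0: "(p \<longlongrightarrow> p0) (at_left 0)" and y0: "(y \<longlongrightarrow> y0) (at_left 0)"
    and trivial: "p0 = 0 \<and> y0 = 0 \<longrightarrow> (\<forall>\<xi><0. p \<xi> = 0 \<and> y \<xi> = 0)"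
    using limits_at_0 by blast
  define l :: "complex^2" where "l = vector [(lam * p0 + of_real q * y0) / of_real (\<omega> * (2 - 1)), y0]"
  have "(v lam \<longlongrightarrow> l) (at_left 0)"
  proof (rule tendsto_vec2)
    show "((\<lambda>x. v lam x $ 2) \<longlongrightarrow> l $ 2) (at_left 0)"
      using y0 by (simp add: l_def y_def)
    have "((\<lambda>\<xi>. (lam * p \<xi> + of_real q * y \<xi>) / of_real (\<omega> * (u \<xi> - 1))) \<longlongrightarrow>
        (lam * p0 + of_real q * y0) / of_real (\<omega> * (2 - 1))) (at_left 0)"
      using omega by (intro tendsto_intros p0 y0 u_0) auto
    moreover have "\<forall>\<^sub>F \<xi> in at_left 0. (lam * p \<xi> + of_real q * y \<xi>) / of_real (\<omega> * (u \<xi> - 1)) = v lam \<xi> $ 1"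
      using eventually_at_left_real[of "-1" 0] by (auto elim!: eventually_mono simp: v1 a_def)
    ultimately show "((\<lambda>x. v lam x $ 1) \<longlongrightarrow> l $ 1) (at_left 0)"
      by (simp add: l_def tendsto_cong)
  qed
  then have "2 * lam * l $ 2 + of_real Fs * (of_real \<omega> * l $ 1 - of_real q * l $ 2) = 0"
    using evans_lopatinsky_eq[where \<phi> = \<phi> and v = v and lam = lam] F assms(3) ahead zero by simp
  moreover have "of_real \<omega> * l $ 1 = lam * p0 + of_real q * y0" "l $ 2 = y0"
    using omega by (simp_all add: l_def)
  \<comment> \<open>At the shock \<open>\<omega> v\<^sub>1 - q v\<^sub>2\<close> is
    \<open>lam p0\<close>, so the determinant splits off the nonzero factor
    \<open>lam\<close>.\<close>
  ultimately have "lam * (2 * y0 + of_real Fs * p0) = 0"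
    by (simp add: algebra_simps)
  then have "p0 = 0 \<and> y0 = 0"
    using boundary_values_zero[OF p0 y0] lam by simp
  then have "\<forall>\<xi><0. v lam \<xi> = 0"
    using trivial v1 by (simp add: vec_eq_iff forall_2 y_def)
  then show False using nontrivial by blast
qed

end

section \<open>The profile in the original variables\<close>

lemma ignition_function_differentiable:
  assumes "ignition_function \<phi> ui" "ui < x"
  shows "\<phi> field_differentiable (at x)" "deriv \<phi> field_differentiable (at x)"
proof -
  have "(deriv ^^ n) \<phi> field_differentiable (at x)" for n
    using assms by (simp add: ignition_function_def smooth_on_def)
  from this[of 0] this[of 1]
  show "\<phi> field_differentiable (at x)" "deriv \<phi> field_differentiable (at x)" by simp_all
qed

locale detonation_wave =
  fixes q k ui s um up us :: real and \<phi> U Z :: "real \<Rightarrow> real"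
  assumes q_nonneg: "0 \<le> q" and k_pos: "0 < k"
    and ignition: "ignition_function \<phi> ui"
    and wave: "strong_detonation q k \<phi> ui s um up us U Z"
begin

lemma states: "0 \<le> up" "up < ui" "ui < um" "up < s" "s < um" "0 < s"
  using wave unfolding strong_detonation_def by auto

lemma U_bot: "(U \<longlongrightarrow> um) at_bot" and Z_bot: "(Z \<longlongrightarrow> 0) at_bot"
  and U_0: "(U \<longlongrightarrow> us) (at_left 0)" and ahead: "\<xi> > 0 \<Longrightarrow> U \<xi> = up \<and> Z \<xi> = 1"
  using wave unfolding strong_detonation_def by auto

lemma Z_0: "(Z \<longlongrightarrow> 1) (at_left 0)" and us_eq: "us = 2 * s - up"
proof -
  obtain zs where zs: "(Z \<longlongrightarrow> zs) (at_left 0)" "s * (1 - zs) = 0"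
    and RH: "s * (up - us) = up\<^sup>2 / 2 - us\<^sup>2 / 2" "us \<noteq> up"
    using wave unfolding strong_detonation_def by auto
  show "(Z \<longlongrightarrow> 1) (at_left 0)"
    using zs states by simp
  have "(up - us) * (up + us - 2 * s) = 0"
    using RH(1) by (simp add: algebra_simps power2_eq_square)
  then show "us = 2 * s - up" using RH(2) by simp
qed

lemma phi_nonneg: "0 \<le> \<phi> x"
  using ignition unfolding ignition_function_def by (cases "x \<le> ui") (simp_all add: less_imp_le)

lemma momentum_deriv: "\<xi> < 0 \<Longrightarrow>
    ((\<lambda>\<xi>. - s * U \<xi> + (U \<xi>)\<^sup>2 / 2) has_real_derivative k * q * \<phi> (U \<xi>) * Z \<xi>) (at \<xi>)"
  using wave unfolding strong_detonation_def by auto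

lemma Z_deriv: "(Z has_real_derivative k * \<phi> (U \<xi>) * Z \<xi> / s) (at \<xi>)" if "\<xi> < 0"
proof -
  have "((\<lambda>\<xi>. - s * Z \<xi>) has_real_derivative - k * \<phi> (U \<xi>) * Z \<xi>) (at \<xi>)"
    using wave that unfolding strong_detonation_def by auto
  from DERIV_cmult[OF this, of "- 1 / s"] show ?thesis
    using states by (simp add: field_simps)
qed

lemma U_differentiable: "U field_differentiable (at \<xi>)" if "\<xi> < 0"
proof -
  have "(deriv ^^ 0) U field_differentiable (at \<xi>)"
    using wave that unfolding strong_detonation_def smooth_on_def by blast
  then show ?thesis by simp
qed

lemma continuous_on_profile: "b < 0 \<Longrightarrow> continuous_on {a..b} U" "b < 0 \<Longrightarrow> continuous_on {a..b} Z"
  by (auto intro!: continuous_at_imp_continuous_on field_differentiable_imp_continuous_at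
    U_differentiable DERIV_isCont[OF Z_deriv])

text \<open>The source of the momentum equation is \<open>q s Z'\<close>, so
  \<open>- s U + U\<^sup>2 / 2 - q s Z\<close> is a first integral. Its value is read off at
  -infinity, and the square is completed.\<close>

lemma parabola: "(U \<xi> - s)\<^sup>2 = (um - s)\<^sup>2 + 2 * q * s * Z \<xi>" if neg: "\<xi> < 0"
proof -
  define e where "e = (\<lambda>\<xi>. (- s * U \<xi> + (U \<xi>)\<^sup>2 / 2) - q * s * Z \<xi>)"
  define l where "l = (- s * um + um\<^sup>2 / 2) - q * s * 0"
  have d: "(e has_real_derivative 0) (at x)" if "x < 0" for x
    unfolding e_def
    by (rule DERIV_cong[OF DERIV_diff[OF momentum_deriv[OF that] DERIV_cmult[OF Z_deriv[OF that]]]])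
      (use states in simp)
  then have d': "((\<lambda>x. - e x) has_real_derivative 0) (at x)" if "x < 0" for x
    using DERIV_minus[OF d[OF that]] by simp
  have e: "(e \<longlongrightarrow> l) at_bot"
    unfolding e_def l_def by (intro tendsto_intros U_bot Z_bot) auto
  \<comment> \<open>The one-sided comparison with the limit is applied to \<open>e\<close> and to
    \<open>- e\<close>.\<close>
  have "l \<le> e \<xi>"
    by (rule limit_at_bot_le[where g = e and g' = "\<lambda>_. 0" and b = 0, OF d _ e neg]) simp_all
  moreover have "- l \<le> - e \<xi>"
    by (rule limit_at_bot_le[where g = "\<lambda>x. - e x" and g' = "\<lambda>_. 0" and b = 0,
          OF d' _ tendsto_minus[OF e] neg]) simp_all
  ultimately have "e \<xi> = l" by simp
  then show ?thesis
    by (simp add: e_def l_def power2_eq_square field_simps)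
qed

lemma parabola_0: "(us - s)\<^sup>2 = (um - s)\<^sup>2 + 2 * q * s"
proof -
  have "((\<lambda>\<xi>. (U \<xi> - s)\<^sup>2) \<longlongrightarrow> (us - s)\<^sup>2) (at_left 0)"
    by (intro tendsto_intros U_0)
  moreover have "((\<lambda>\<xi>. (U \<xi> - s)\<^sup>2) \<longlongrightarrow> (um - s)\<^sup>2 + 2 * q * s * 1) (at_left 0)"
  proof (rule Lim_transform_eventually)
    show "((\<lambda>\<xi>. (um - s)\<^sup>2 + 2 * q * s * Z \<xi>) \<longlongrightarrow> (um - s)\<^sup>2 + 2 * q * s * 1) (at_left 0)"
      by (intro tendsto_intros Z_0)
    show "\<forall>\<^sub>F \<xi> in at_left 0. (um - s)\<^sup>2 + 2 * q * s * Z \<xi> = (U \<xi> - s)\<^sup>2"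
      using eventually_at_left_real[of "-1" 0] by (auto elim!: eventually_mono simp: parabola)
  qed
  ultimately show ?thesis
    using tendsto_unique[of "at_left (0::real)"] by fastforce
qed

text \<open>
  Nothing excludes a priori that \<open>\<phi>\<close> is unbounded near \<open>ui\<close>, so linear uniqueness for \<open>Z\<close> is available
  only once \<open>U \<ge> um\<close> is known, which needs \<open>Z \<ge> 0\<close>.  The latter holds because \<open>Z\<^sup>2\<close> is nondecreasing.
\<close>

lemma Z_nonneg: "0 \<le> Z \<xi>" if neg: "\<xi> < 0"
proof (rule ccontr)
  assume "\<not> 0 \<le> Z \<xi>"
  have "\<forall>\<^sub>F x in at_left 0. 0 < Z x" by (rule order_tendstoD(1)[OF Z_0]) simp
  then have "\<forall>\<^sub>F x in at_left 0. 0 < Z x \<and> x \<in> {\<xi><..<0}"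
    using eventually_at_left_real[OF neg] by (rule eventually_conj)
  then obtain b where b: "0 < Z b" "\<xi> < b" "b < 0"
    using eventually_happens'[OF trivial_limit_at_left_real] by fastforce
  have "\<exists>x\<ge>\<xi>. x \<le> b \<and> Z x = 0"
    by (rule IVT'[OF _ _ _ continuous_on_profile(2)]) (use b \<open>\<not> 0 \<le> Z \<xi>\<close> in simp_all)
  then obtain x where x: "\<xi> \<le> x" "x \<le> b" "Z x = 0"
    by blast
  have "(Z \<xi>)\<^sup>2 \<le> (Z x)\<^sup>2"
  proof (rule nondecreasing_below[where g = "\<lambda>\<xi>. (Z \<xi>)\<^sup>2" and b = 0 and g' = "\<lambda>\<xi>. 2 * k * \<phi> (U \<xi>) / s * (Z \<xi>)\<^sup>2"])
    fix x :: real assume "x < 0"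
    show "((\<lambda>\<xi>. (Z \<xi>)\<^sup>2) has_real_derivative 2 * k * \<phi> (U x) / s * (Z x)\<^sup>2) (at x)"
      by (rule DERIV_cong[OF DERIV_power[OF Z_deriv[OF \<open>x < 0\<close>]]]) (simp add: power2_eq_square)
    show "0 \<le> 2 * k * \<phi> (U x) / s * (Z x)\<^sup>2"
      using k_pos states phi_nonneg by simp
  qed (use x b in auto)
  then show False using \<open>\<not> 0 \<le> Z \<xi>\<close> x(3) by simp
qed

text \<open>Selects the branch of the square root in \<open>parabola\<close>: as
  \<open>Z \<ge> 0\<close>, the value \<open>U = s\<close> is excluded, and \<open>U\<close> starts
  near \<open>um > s\<close>.\<close>

lemma U_gt_s: "s < U \<xi>" if neg: "\<xi> < 0"
proof (rule ccontr)
  assume "\<not> s < U \<xi>"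
  have "\<forall>\<^sub>F x in at_bot. s < U x \<and> x < \<xi>"
    using order_tendstoD(1)[OF U_bot] states by (intro eventually_conj eventually_gt_at_bot) auto
  then obtain b where b: "s < U b" "b < \<xi>"
    using eventually_happens'[OF trivial_limit_at_bot_linorder] by blast
  have "\<exists>x\<ge>b. x \<le> \<xi> \<and> U x = s"
    by (rule IVT2'[OF _ _ _ continuous_on_profile(1)[OF neg]]) (use b \<open>\<not> s < U \<xi>\<close> in simp_all)
  then obtain x where "b \<le> x" "x \<le> \<xi>" "U x = s"
    by blast
  then have "0 = (um - s)\<^sup>2 + 2 * q * s * Z x" "0 \<le> 2 * q * s * Z x"
    using parabola[of x] Z_nonneg[of x] q_nonneg states neg by auto
  then show False using states zero_less_power2[of "um - s"] by linarith
qed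

lemma Z_le: "Z \<xi> \<le> 1" if "\<xi> < 0"
proof (rule le_limit_at_left[where b = 0, OF _ _ Z_0 that])
  fix x :: real assume x: "x < 0"
  show "(Z has_real_derivative k * \<phi> (U x) * Z x / s) (at x)" by (rule Z_deriv[OF x])
  show "0 \<le> k * \<phi> (U x) * Z x / s"
    using k_pos states(6) phi_nonneg[of "U x"] Z_nonneg[OF x] by simp
qed

lemma us_gt: "s < us"
  using us_eq states by simp

lemma U_bounds: "um \<le> U \<xi>" "U \<xi> \<le> us" if "\<xi> < 0"
proof -
  have "0 \<le> 2 * q * s * Z \<xi>" "2 * q * s * Z \<xi> \<le> 2 * q * s * 1"
    using q_nonneg states Z_nonneg[OF that] Z_le[OF that] by (auto intro!: mult_left_mono)
  then have "(um - s)\<^sup>2 \<le> (U \<xi> - s)\<^sup>2" "(U \<xi> - s)\<^sup>2 \<le> (us - s)\<^sup>2"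
    using parabola[OF that] parabola_0 by auto
  then have "um - s \<le> U \<xi> - s" "U \<xi> - s \<le> us - s"
    using U_gt_s[OF that] us_gt by (simp_all add: power2_le_imp_le[of "um - s" "U \<xi> - s", simplified]
      power2_le_imp_le[of "U \<xi> - s" "us - s", simplified])
  then show "um \<le> U \<xi>" "U \<xi> \<le> us" by simp_all
qed

lemma um_le_us: "um \<le> us"
  using order_trans[OF U_bounds[of "-1"]] by simp

lemma phi_continuous: "continuous_on {um..us} \<phi>" and deriv_phi_continuous: "continuous_on {um..us} (deriv \<phi>)"
  using ignition_function_differentiable[OF ignition] states
  by (auto intro!: continuous_at_imp_continuous_on field_differentiable_imp_continuous_at)

text \<open>The profile stays in the compact interval from \<open>um\<close> to \<open>us\<close>,
  strictly above the ignition level, where \<phi> is positive and smooth. Hence the uniform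
  constants required by \<open>detonation_profile\<close>.\<close>

lemma phi_bounds: "\<exists>F0 F1 D1. 0 < F0 \<and> (\<forall>x\<in>{um..us}. F0 \<le> \<phi> x \<and> \<phi> x \<le> F1 \<and> \<bar>deriv \<phi> x\<bar> \<le> D1)"
proof -
  have ne: "compact {um..us}" "{um..us} \<noteq> {}" using um_le_us by auto
  obtain x0 where x0: "x0 \<in> {um..us}" "\<And>x. x \<in> {um..us} \<Longrightarrow> \<phi> x0 \<le> \<phi> x"
    using continuous_attains_inf[OF ne phi_continuous] by blast
  obtain x1 where x1: "\<And>x. x \<in> {um..us} \<Longrightarrow> \<phi> x \<le> \<phi> x1"
    using continuous_attains_sup[OF ne phi_continuous] by blast
  obtain x2 where x2: "\<And>x. x \<in> {um..us} \<Longrightarrow> \<bar>deriv \<phi> x\<bar> \<le> \<bar>deriv \<phi> x2\<bar>"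
    using continuous_attains_sup[OF ne continuous_on_rabs[OF deriv_phi_continuous]] by blast
  have "0 < \<phi> x0"
    using x0(1) states ignition unfolding ignition_function_def by auto
  then show ?thesis using x0(2) x1 x2 by blast
qed

text \<open>With \<open>C\<close> bounding the rate \<open>k \<phi>(U) / s\<close>, the product
  \<open>Z exp (- C \<xi>)\<close> is nonincreasing and therefore at least its limit 1 at the
  shock.\<close>

lemma Z_pos: "0 < Z \<xi>" if neg: "\<xi> < 0"
proof -
  obtain F1 where F1: "\<And>x. x \<in> {um..us} \<Longrightarrow> \<phi> x \<le> F1"
    using phi_bounds by meson
  define C where "C = k * F1 / s"
  have "- (Z \<xi> * exp (- C * \<xi>)) \<le> - (1 * exp (- C * 0))"
  proof (rule le_limit_at_left[where g = "\<lambda>\<xi>. - (Z \<xi> * exp (- C * \<xi>))" and b = 0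
        and g' = "\<lambda>\<xi>. (C - k * \<phi> (U \<xi>) / s) * (Z \<xi> * exp (- C * \<xi>))"])
    fix x :: real assume x: "x < 0"
    show "((\<lambda>\<xi>. - (Z \<xi> * exp (- C * \<xi>))) has_real_derivative (C - k * \<phi> (U x) / s) * (Z x * exp (- C * x))) (at x)"
      by (auto intro!: derivative_eq_intros Z_deriv x simp: algebra_simps)
    have "k * \<phi> (U x) / s \<le> C"
      unfolding C_def using F1[of "U x"] U_bounds[OF x] k_pos states
      by (intro divide_right_mono mult_left_mono) auto
    then show "0 \<le> (C - k * \<phi> (U x) / s) * (Z x * exp (- C * x))"
      using Z_nonneg[OF x] by simp
  next
    show "((\<lambda>\<xi>. - (Z \<xi> * exp (- C * \<xi>))) \<longlongrightarrow> - (1 * exp (- C * 0))) (at_left 0)"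
      by (intro tendsto_intros Z_0)
  qed (fact neg)
  then have "0 < Z \<xi> * exp (- C * \<xi>)" by simp
  then show ?thesis by (simp add: zero_less_mult_iff)
qed

lemma U_deriv: "(U has_real_derivative k * q * \<phi> (U \<xi>) * Z \<xi> / (U \<xi> - s)) (at \<xi>)" if neg: "\<xi> < 0"
proof -
  obtain U' where U': "(U has_real_derivative U') (at \<xi>)"
    using U_differentiable[OF neg] unfolding field_differentiable_def by blast
  have "((\<lambda>\<xi>. - s * U \<xi> + (U \<xi>)\<^sup>2 / 2) has_real_derivative (U \<xi> - s) * U') (at \<xi>)"
    by (auto intro!: derivative_eq_intros U' simp: algebra_simps)
  from DERIV_unique[OF this momentum_deriv[OF neg]]
  have "U' = k * q * \<phi> (U \<xi>) * Z \<xi> / (U \<xi> - s)"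
    using U_gt_s[OF neg] by (simp add: field_simps)
  with U' show ?thesis by simp
qed

text \<open>On the profile, \<open>parabola\<close> turns the denominator of the hypothesis into
  \<open>2 q s Z\<close> and the Rankine-Hugoniot relation turns its numerator into
  \<open>2 (U - s)\<close>. For \<open>q > 0\<close> the denominator is positive and can be
  cleared.\<close>

lemma growth_condition:
  assumes growth: "\<And>u. u \<in> {um<..us} \<Longrightarrow>
      deriv (\<lambda>u. ln (\<phi> u)) u \<le> (2 * u - us - up) / ((u - us) * (u - up) + q * (us + up))"
    and neg: "\<xi> < 0"
  shows "q * s * Z \<xi> * deriv \<phi> (U \<xi>) \<le> (U \<xi> - s) * \<phi> (U \<xi>)"
proof (cases "q = 0")
  case True
  then show ?thesis using U_gt_s[OF neg] phi_nonneg by simp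
next
  case False
  then have qsZ: "0 < q * s * Z \<xi>"
    using q_nonneg states Z_pos[OF neg] by simp
  \<comment> \<open>Strict positivity of \<open>Z\<close> keeps \<open>U\<close> off the endpoint
    \<open>um\<close>, which the hypothesis leaves out.\<close>
  then have "um - s \<noteq> U \<xi> - s"
    using parabola[OF neg] by auto
  then have U: "U \<xi> \<in> {um<..us}"
    using U_bounds[OF neg] by auto
  then have "ui < U \<xi>" using states by auto
  then have phi: "0 < \<phi> (U \<xi>)" "(\<phi> has_real_derivative deriv \<phi> (U \<xi>)) (at (U \<xi>))"
    using ignition ignition_function_differentiable(1)[OF ignition]
    by (auto simp: ignition_function_def field_differentiable_derivI)
  then have "deriv (\<lambda>u. ln (\<phi> u)) (U \<xi>) = deriv \<phi> (U \<xi>) / \<phi> (U \<xi>)"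
    by (intro DERIV_imp_deriv) (auto intro!: derivative_eq_intros)
  moreover have "(U \<xi> - us) * (U \<xi> - up) + q * (us + up) = 2 * (q * s * Z \<xi>)"
    using parabola[OF neg] parabola_0 by (simp add: us_eq power2_eq_square algebra_simps)
  ultimately have "deriv \<phi> (U \<xi>) / \<phi> (U \<xi>) \<le> (2 * (U \<xi> - s)) / (2 * (q * s * Z \<xi>))"
    using growth[OF U] by (simp add: us_eq)
  then have "deriv \<phi> (U \<xi>) / \<phi> (U \<xi>) \<le> (U \<xi> - s) / (q * s * Z \<xi>)"
    by (simp only: mult_divide_mult_cancel_left_if) simp
  then show ?thesis
    using phi(1) qsZ by (simp add: divide_simps mult.commute)
qed


section \<open>Passage to the rescaled variables\<close>

lemma resc_phi_deriv:
  assumes "ui < up + (s - up) * x"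
  shows "(resc_phi s up k \<phi> has_real_derivative k * (s - up) * deriv \<phi> (up + (s - up) * x)) (at x)"
proof -
  have phi: "(\<phi> has_real_derivative deriv \<phi> (up + (s - up) * x)) (at (up + (s - up) * x))"
    using ignition_function_differentiable(1)[OF ignition assms] by (simp add: field_differentiable_derivI)
  have "((\<lambda>x. up + (s - up) * x) has_real_derivative s - up) (at x)"
    by (auto intro!: derivative_eq_intros)
  from DERIV_cmult[OF DERIV_chain2[OF phi this], of k] show ?thesis
    unfolding resc_phi_def by (simp add: ac_simps)
qed

lemma resc_back: "up + (s - up) * resc_U s up U \<xi> = U (s * \<xi>)"
  using states by (simp add: resc_U_def)

lemma rescaled_time:
  "filterlim (\<lambda>\<xi>. s * \<xi>) at_bot at_bot" "filterlim (\<lambda>\<xi>. s * \<xi>) (at_left 0) (at_left 0)"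
proof -
  show "filterlim (\<lambda>\<xi>. s * \<xi>) at_bot at_bot"
    using states by (intro filterlim_tendsto_pos_mult_at_bot[OF tendsto_const _ filterlim_ident]) auto
  have "((\<lambda>\<xi>. s * \<xi>) \<longlongrightarrow> s * 0) (at_left 0)"
    by (intro tendsto_intros)
  moreover have "\<forall>\<^sub>F \<xi> in at_left 0. s * \<xi> \<in> {..<0} \<and> s * \<xi> \<noteq> 0"
    using eventually_at_left_real[of "-1" 0] states by (auto elim!: eventually_mono simp: mult_less_0_iff)
  ultimately show "filterlim (\<lambda>\<xi>. s * \<xi>) (at_left 0) (at_left 0)"
    by (simp add: filterlim_at)
qed

lemma rescaled_profile:
  assumes growth: "\<And>u. u \<in> {um<..us} \<Longrightarrow>
      deriv (\<lambda>u. ln (\<phi> u)) u \<le> (2 * u - us - up) / ((u - us) * (u - up) + q * (us + up))"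
  shows "\<exists>F0 F1 D1. detonation_profile (resc_omega s up) (resc_q s up q) ((um - up) / (s - up)) F0 F1 D1
      (k * \<phi> us) (resc_U s up U) (resc_Z s Z)
      (\<lambda>\<xi>. resc_phi s up k \<phi> (resc_U s up U \<xi>)) (\<lambda>\<xi>. deriv (resc_phi s up k \<phi>) (resc_U s up U \<xi>))"
proof -
  define d where "d = s - up"
  have d: "0 < d" "d \<le> s" using states by (simp_all add: d_def)
  have s: "0 < s" using states by simp
  obtain F0 F1 D1 where F0: "0 < F0"
    and b: "\<forall>x\<in>{um..us}. F0 \<le> \<phi> x \<and> \<phi> x \<le> F1 \<and> \<bar>deriv \<phi> x\<bar> \<le> D1"
    using phi_bounds by meson
  have F: "resc_phi s up k \<phi> (resc_U s up U \<xi>) = k * \<phi> (U (s * \<xi>))" for \<xi>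
    by (simp add: resc_phi_def resc_back)
  have neg: "s * \<xi> < 0" if "\<xi> < 0" for \<xi>
    using that s by (simp add: mult_less_0_iff)
  have U: "U (s * \<xi>) \<in> {um..us}" if "\<xi> < 0" for \<xi>
    using U_bounds[OF neg[OF that]] by simp
  have D: "deriv (resc_phi s up k \<phi>) (resc_U s up U \<xi>) = k * d * deriv \<phi> (U (s * \<xi>))" if "\<xi> < 0" for \<xi>
    unfolding d_def resc_back[symmetric]
    by (intro DERIV_imp_deriv resc_phi_deriv) (use U[OF that] states in \<open>simp add: resc_back\<close>)
  \<comment> \<open>The sonic value \<open>U = s\<close> is the rescaled value 1.\<close>
  have w: "resc_omega s up * (resc_U s up U \<xi> - 1) = (U (s * \<xi>) - s) / s" for \<xi>
    using d s by (simp add: resc_omega_def resc_U_def d_def[symmetric] field_simps) (simp add: d_def algebra_simps)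
  have time: "((\<lambda>\<xi>. s * \<xi>) has_real_derivative s) (at \<xi>)" for \<xi>
    by (auto intro!: derivative_eq_intros)
  have Ud: "(resc_U s up U has_real_derivative
      resc_q s up q * (k * \<phi> (U (s * \<xi>))) * Z (s * \<xi>) / ((U (s * \<xi>) - s) / s)) (at \<xi>)" if "\<xi> < 0" for \<xi>
  proof -
    have "((\<lambda>\<xi>. U (s * \<xi>) - up) has_real_derivative
        k * q * \<phi> (U (s * \<xi>)) * Z (s * \<xi>) / (U (s * \<xi>) - s) * s - 0) (at \<xi>)"
      by (intro DERIV_diff DERIV_chain2[OF U_deriv[OF neg[OF that]] time] DERIV_const)
    from DERIV_cdivide[OF this, of d] show ?thesis
      unfolding resc_U_def resc_q_def d_def[symmetric] by (simp add: ac_simps)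
  qed
  have "detonation_profile (resc_omega s up) (resc_q s up q) ((um - up) / (s - up)) (k * F0) (k * F1) (k * d * D1)
      (k * \<phi> us) (resc_U s up U) (resc_Z s Z)
      (\<lambda>\<xi>. resc_phi s up k \<phi> (resc_U s up U \<xi>)) (\<lambda>\<xi>. deriv (resc_phi s up k \<phi>) (resc_U s up U \<xi>))"
  proof
    show "0 < resc_omega s up" "resc_omega s up \<le> 1" "0 \<le> resc_q s up q"
      using d s q_nonneg states by (simp_all add: resc_omega_def resc_q_def)
    show "1 < (um - up) / (s - up)" using states by simp
    show "0 < k * F0" using F0 k_pos by simp
    show "(resc_Z s Z \<longlongrightarrow> 0) at_bot"
      unfolding resc_Z_def by (rule filterlim_compose[OF Z_bot rescaled_time(1)])
    show "(resc_Z s Z \<longlongrightarrow> 1) (at_left 0)"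
      unfolding resc_Z_def by (rule filterlim_compose[OF Z_0 rescaled_time(2)])
    have U0: "((\<lambda>\<xi>. U (s * \<xi>)) \<longlongrightarrow> us) (at_left 0)"
      by (rule filterlim_compose[OF U_0 rescaled_time(2)])
    have "(resc_U s up U \<longlongrightarrow> (us - up) / (s - up)) (at_left 0)"
      unfolding resc_U_def using states by (intro tendsto_intros U0) auto
    moreover have "(us - up) / (s - up) = 2"
      using states by (simp add: us_eq field_simps)
    ultimately show "(resc_U s up U \<longlongrightarrow> 2) (at_left 0)" by simp
    have "isCont \<phi> us"
      using ignition_function_differentiable(1)[OF ignition] states um_le_us
      by (intro field_differentiable_imp_continuous_at) simp
    then show "((\<lambda>\<xi>. resc_phi s up k \<phi> (resc_U s up U \<xi>)) \<longlongrightarrow> k * \<phi> us) (at_left 0)"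
      unfolding F by (intro tendsto_intros isCont_tendsto_compose[OF _ U0])
  next
    fix \<xi> :: real assume neg': "\<xi> < 0"
    note U = U[OF neg'] and D = D[OF neg'] and neg = neg[OF neg']
    show "(um - up) / (s - up) \<le> resc_U s up U \<xi>" "resc_U s up U \<xi> \<le> 2"
      using U states by (auto simp: resc_U_def us_eq divide_right_mono pos_divide_le_eq)
    show "0 < resc_Z s Z \<xi>" "resc_Z s Z \<xi> \<le> 1"
      using Z_pos[OF neg] Z_le[OF neg] by (simp_all add: resc_Z_def)
    show "k * F0 \<le> resc_phi s up k \<phi> (resc_U s up U \<xi>)" "resc_phi s up k \<phi> (resc_U s up U \<xi>) \<le> k * F1"
      using b U k_pos unfolding F by auto
    have "\<bar>deriv \<phi> (U (s * \<xi>))\<bar> \<le> D1" using b U by blast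
    then show "\<bar>deriv (resc_phi s up k \<phi>) (resc_U s up U \<xi>)\<bar> \<le> k * d * D1"
      unfolding D abs_mult using k_pos d by (simp add: mult_left_mono)
    show "(resc_U s up U has_real_derivative resc_q s up q * resc_phi s up k \<phi> (resc_U s up U \<xi>) * resc_Z s Z \<xi> /
        (resc_omega s up * (resc_U s up U \<xi> - 1))) (at \<xi>)"
      using Ud[OF neg'] unfolding F w resc_Z_def .
    show "(resc_Z s Z has_real_derivative resc_phi s up k \<phi> (resc_U s up U \<xi>) * resc_Z s Z \<xi>) (at \<xi>)"
      unfolding F resc_Z_def
      by (rule DERIV_cong[OF DERIV_chain2[OF Z_deriv[OF neg] time]]) (use s in simp)
    have "ui < up + (s - up) * resc_U s up U \<xi>"
      using U states by (simp add: resc_back)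
    note phi = resc_phi_deriv[OF this]
    show "((\<lambda>\<xi>. resc_phi s up k \<phi> (resc_U s up U \<xi>)) has_real_derivative
        deriv (resc_phi s up k \<phi>) (resc_U s up U \<xi>) * (resc_q s up q * resc_phi s up k \<phi> (resc_U s up U \<xi>) *
        resc_Z s Z \<xi> / (resc_omega s up * (resc_U s up U \<xi> - 1)))) (at \<xi>)"
      using DERIV_chain2[OF phi Ud[OF neg']] unfolding DERIV_imp_deriv[OF phi] F w resc_Z_def .
    \<comment> \<open>The rescaled inequality is the original one times \<open>k / s\<close>: the
      factor \<open>d\<close> from the chain rule cancels the one in \<open>resc_q\<close>.\<close>
    have "k * (q * s * Z (s * \<xi>) * deriv \<phi> (U (s * \<xi>))) \<le> k * ((U (s * \<xi>) - s) * \<phi> (U (s * \<xi>)))"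
      using growth_condition[OF growth neg] k_pos by (intro mult_left_mono) auto
    then have "k * (q * s * Z (s * \<xi>) * deriv \<phi> (U (s * \<xi>))) / s \<le> k * ((U (s * \<xi>) - s) * \<phi> (U (s * \<xi>))) / s"
      using s by (intro divide_right_mono) auto
    moreover have "resc_q s up q * resc_Z s Z \<xi> * (k * d * deriv \<phi> (U (s * \<xi>)))
        = k * (q * s * Z (s * \<xi>) * deriv \<phi> (U (s * \<xi>))) / s"
      using d s by (simp add: resc_q_def resc_Z_def d_def[symmetric])
    ultimately show "resc_q s up q * resc_Z s Z \<xi> * deriv (resc_phi s up k \<phi>) (resc_U s up U \<xi>)
        \<le> resc_omega s up * (resc_U s up U \<xi> - 1) * resc_phi s up k \<phi> (resc_U s up U \<xi>)"
      unfolding F D w by (simp add: ac_simps)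
  qed
  then show ?thesis by blast
qed

end

theorem theorem4p4:
  fixes q k ui s um up us :: real and \<phi> U Z :: "real \<Rightarrow> real"
  assumes "0 \<le> q" and "0 < k"
    and "ignition_function \<phi> ui"
    and "strong_detonation q k \<phi> ui s um up us U Z"
    and "\<And>u. u \<in> {um<..us} \<Longrightarrow>
           deriv (\<lambda>u. ln (\<phi> u)) u
             \<le> (2 * u - us - up) / ((u - us) * (u - up) + q * (us + up))"
  shows "weakly_spectrally_stable q k \<phi> s up U Z"
proof -
  interpret detonation_wave q k ui s um up us \<phi> U Z
    using assms(1-4) by unfold_locales
  obtain F0 F1 D1 where "detonation_profile (resc_omega s up) (resc_q s up q) ((um - up) / (s - up)) F0 F1 D1
      (k * \<phi> us) (resc_U s up U) (resc_Z s Z)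
      (\<lambda>\<xi>. resc_phi s up k \<phi> (resc_U s up U \<xi>)) (\<lambda>\<xi>. deriv (resc_phi s up k \<phi>) (resc_U s up U \<xi>))"
    using rescaled_profile[OF assms(5)] by blast
  then interpret profile: detonation_profile "resc_omega s up" "resc_q s up q" "(um - up) / (s - up)" F0 F1 D1
    "k * \<phi> us" "resc_U s up U" "resc_Z s Z"
    "\<lambda>\<xi>. resc_phi s up k \<phi> (resc_U s up U \<xi>)" "\<lambda>\<xi>. deriv (resc_phi s up k \<phi>) (resc_U s up U \<xi>)" .
  \<comment> \<open>The rescaled state 0 is \<open>up\<close>, which lies below the ignition
    level.\<close>
  have "resc_phi s up k \<phi> 0 = 0"
    using ignition states by (simp add: resc_phi_def ignition_function_def)
  moreover have "resc_U s up U \<xi> = 0 \<and> resc_Z s Z \<xi> = 1" if "0 < \<xi>" for \<xi>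
    using ahead[of "s * \<xi>"] that states by (simp add: resc_U_def resc_Z_def)
  ultimately show ?thesis
    unfolding weakly_spectrally_stable_def Let_def
    using profile.evans_lopatinsky_nonzero[OF refl refl] by blast
qed

end
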